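(* Let $n\ge1$ and $1\le r\le n$, and consider a uniformly random domino tiling of the Aztec diamond $A_n$. (1) Let $\{h_1,\dots,h_r\}\subseteq\{0,\dots,n\}$ be a set of $r$ distinct integers and let $Z_r(h)$ be the zig-zag path in $A_n$ from $(-r,n+1-r)$ to $(n+1-r,-r)$ around white squares whose east/south turns are exactly at the positions $h_1,\dots,h_r$. Then the probability that the zig-zag path determined by the random tiling equals $Z_r(h)$ is given by the Krawtchouk ensemble with $r$ particles, $K=n$, $p=1/2$, regarded as a measure on unordered configurations: $$P[Z_r(h)]=r!\;\mathbb P_{\mathrm{Kr},r,n,1/2}[(h_1,\dots,h_r)].$$ (2) Let $\{h_1,\dots,h_r\}\subseteq\{0,\dots,n-1\}$ be a set of $r$ distinct integers and let $Z_r'(h)$ be the zig-zag path in $A_n$ from $(-r,n-r)$ to $(n-r,-r)$ around black squares whose south/east turns are exactly at the positions $h_1,\dots,h_r$. Then $$P[Z_r'(h)]=r!\;\mathbb P_{\mathrm{Kr},r,n-1,1/2}[(h_1,\dots,h_r)].$$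
   Context: A domino is a closed $1\times2$ or $2\times1$ rectangle in $\mathbb R^2$ with corners in $\mathbb Z^2$; a tiling of a region is a set of dominoes with disjoint interiors whose union is the region. The Aztec diamond $A_n$ is the union of all lattice squares $[m,m+1]\times[l,l+1]$, $m,l\in\mathbb Z$, lying inside $\{(x,y):|x|+|y|\le n+1\}$. All domino tilings of $A_n$ (there are $2^{n(n+1)/2}$) are equally likely. The squares of $A_n$ are colored in checkerboard fashion so that the leftmost square in each row of the top half is white. White zig-zag paths: for $1\le r\le n$ let $Q_k^r=(-r+k,\,n+1-k-r)$, $k=0,\dots,n+1$. The squares with opposite corners $Q_k^r,Q_{k+1}^r$ ($k=0,\dots,n$) form a diagonal of white squares. A zig-zag path from $Q_0^r$ to $Q_{n+1}^r$ is a path of unit edges which, for each $k=0,\dots,n$, goes from $Q_k^r$ to $Q_{k+1}^r$ either first one step east and then one step south (an east/south turn at position $k$) or first one step south and then one step east (a south/east turn at position $k$). Each domino tiling of $A_n$ determines a unique such zig-zag path by requiring that the path does not intersect (the interiors of) the dominoes; it has exactly $r$ east/south turns. Black zig-zag paths are defined in the same way from $P_0^r=(-r,n-r)$ to $P_n^r=(n-r,-r)$, with $P_k^r=(-r+k,\,n-r-k)$, $k=0,\dots,n$, going around the black squares with opposite corners $P_k^r,P_{k+1}^r$, positions $k=0,\dots,n-1$. Krawtchouk ensemble: the probability measure on $\{0,\dots,K\}^N$ given by $$\mathbb P_{\mathrm{Kr},N,K,p}[h]=\frac1{Z_{N,K,p}}\prod_{1\le i<j\le N}(h_j-h_i)^2\prod_{j=1}^N\binom{K}{h_j}p^{h_j}(1-p)^{K-h_j},$$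 $$Z_{N,K,p}=N!\Bigl(\prod_{j=0}^{N-1}\frac{j!}{(K-j)!}\Bigr)(K!)^N(p(1-p))^{N(N-1)/2}.$$ *)

theory Defs
  imports "HOL-Probability.Probability"
begin

definition domino :: "(real \<times> real) set \<Rightarrow> bool" where
  "domino D \<longleftrightarrow> (\<exists>a b :: int.
     D = {of_int a .. of_int a + 2} \<times> {of_int b .. of_int b + 1} \<or>
     D = {of_int a .. of_int a + 1} \<times> {of_int b .. of_int b + 2})"

definition domino_tiling :: "(real \<times> real) set set \<Rightarrow> (real \<times> real) set \<Rightarrow> bool" where
  "domino_tiling T R \<longleftrightarrow>
     (\<forall>D\<in>T. domino D) \<and>
     pairwise (\<lambda>D D'. interior D \<inter> interior D' = {}) T \<and>
     \<Union>T = R"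

definition lattice_square :: "int \<Rightarrow> int \<Rightarrow> (real \<times> real) set" where
  "lattice_square m l = {of_int m .. of_int m + 1} \<times> {of_int l .. of_int l + 1}"

definition aztec :: "nat \<Rightarrow> (real \<times> real) set" where
  "aztec n = \<Union> {lattice_square m l | m l.
     lattice_square m l \<subseteq> {(x, y). \<bar>x\<bar> + \<bar>y\<bar> \<le> real n + 1}}"

definition aztec_tilings :: "nat \<Rightarrow> (real \<times> real) set set set" where
  "aztec_tilings n = {T. domino_tiling T (aztec n)}"

definition random_tiling :: "nat \<Rightarrow> (real \<times> real) set set pmf" where
  "random_tiling n = pmf_of_set (aztec_tilings n)"

text \<open>
  A zig-zag path is represented by the list of its successive lattice points.
  For corner points \<open>C 0, \<dots>, C m\<close> with \<open>C (k + 1) = C k + (1, -1)\<close>, the path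
  \<open>zigzag_path C m E\<close> from \<open>C 0\<close> to \<open>C m\<close> has an east/south turn at each
  position \<open>k < m\<close> with \<open>k \<in> E\<close> and a south/east turn at every other position.
\<close>

definition zigzag_path :: "(nat \<Rightarrow> real \<times> real) \<Rightarrow> nat \<Rightarrow> nat set \<Rightarrow> (real \<times> real) list" where
  "zigzag_path C m E =
     concat (map (\<lambda>k. [C k, C k + (if k \<in> E then (1, 0) else (0, -1))]) [0..<m]) @ [C m]"

definition zigzag_paths :: "(nat \<Rightarrow> real \<times> real) \<Rightarrow> nat \<Rightarrow> (real \<times> real) list set" where
  "zigzag_paths C m = {zigzag_path C m E | E. E \<subseteq> {..<m}}"

definition polyline :: "(real \<times> real) list \<Rightarrow> (real \<times> real) set" where
  "polyline \<gamma> = (\<Union>i < length \<gamma> - 1. closed_segment (\<gamma> ! i) (\<gamma> ! Suc i))"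

definition tiling_zigzag ::
  "(nat \<Rightarrow> real \<times> real) \<Rightarrow> nat \<Rightarrow> (real \<times> real) set set \<Rightarrow> (real \<times> real) list" where
  "tiling_zigzag C m T =
     (THE \<gamma>. \<gamma> \<in> zigzag_paths C m \<and> (\<forall>D\<in>T. polyline \<gamma> \<inter> interior D = {}))"

text \<open>
  The checkerboard colour with the leftmost square of every row of the top half white makes
  the squares with opposite corners \<open>white_corner n r k\<close> and \<open>white_corner n r (k + 1)\<close>,
  \<open>0 \<le> k \<le> n\<close>, white, and those with opposite corners \<open>black_corner n r k\<close> and
  \<open>black_corner n r (k + 1)\<close>, \<open>0 \<le> k \<le> n - 1\<close>, black.
\<close>

definition white_corner :: "nat \<Rightarrow> nat \<Rightarrow> nat \<Rightarrow> real \<times> real" where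
  "white_corner n r k = (- real r + real k, real n + 1 - real k - real r)"

definition black_corner :: "nat \<Rightarrow> nat \<Rightarrow> nat \<Rightarrow> real \<times> real" where
  "black_corner n r k = (- real r + real k, real n - real r - real k)"

definition white_zigzag :: "nat \<Rightarrow> nat \<Rightarrow> (real \<times> real) set set \<Rightarrow> (real \<times> real) list" where
  "white_zigzag n r T = tiling_zigzag (white_corner n r) (n + 1) T"

definition black_zigzag :: "nat \<Rightarrow> nat \<Rightarrow> (real \<times> real) set set \<Rightarrow> (real \<times> real) list" where
  "black_zigzag n r T = tiling_zigzag (black_corner n r) n T"

text \<open>
  \<open>white_path_at n r H\<close> has its east/south turns exactly at the positions in \<open>H\<close>, whereas
  \<open>black_path_at n r H\<close> has its south/east turns exactly at the positions in \<open>H\<close>.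
\<close>

definition white_path_at :: "nat \<Rightarrow> nat \<Rightarrow> nat set \<Rightarrow> (real \<times> real) list" where
  "white_path_at n r H = zigzag_path (white_corner n r) (n + 1) H"

definition black_path_at :: "nat \<Rightarrow> nat \<Rightarrow> nat set \<Rightarrow> (real \<times> real) list" where
  "black_path_at n r H = zigzag_path (black_corner n r) n ({..<n} - H)"

definition krawtchouk_Z :: "nat \<Rightarrow> nat \<Rightarrow> real \<Rightarrow> real" where
  "krawtchouk_Z N K p =
     fact N * (\<Prod>j<N. fact j / fact (K - j)) * fact K ^ N * (p * (1 - p)) ^ (N * (N - 1) div 2)"

text \<open>A configuration \<open>(h\<^sub>1, \<dots>, h\<^sub>N)\<close> is a function on indices, read on \<open>{1..N}\<close> only.\<close>

definition krawtchouk :: "nat \<Rightarrow> nat \<Rightarrow> real \<Rightarrow> (nat \<Rightarrow> nat) \<Rightarrow> real" where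
  "krawtchouk N K p h =
     1 / krawtchouk_Z N K p *
     (\<Prod>(i, j) \<in> {(i, j). 1 \<le> i \<and> i < j \<and> j \<le> N}. (real (h j) - real (h i))\<^sup>2) *
     (\<Prod>j = 1..N. real (K choose h j) * p ^ h j * (1 - p) ^ (K - h j))"

end

theory Submission
  imports Defs "Jordan_Normal_Form.Determinant"
begin

text \<open>
  Cut the Aztec diamond along its diagonals. Dominoes are edges between neighbouring diagonals, so a
  tiling is a perfect matching, and the zig-zag path along a diagonal records which of its squares
  are matched towards the upper right. Given this set of squares, the tilings of the two sides of
  the path are independent, and the reflection exchanging the two sides reduces the lower left
  count to the upper right one.

  The upper right count is computed one diagonal at a time. A square has at most two neighbours on the
  next diagonal, so passing to the next diagonal is a sum over injective choices of neighbours.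
  If the counts on a diagonal are proportional to a Vandermonde product, this sum is a
  determinant by multilinearity (non-injective choices contribute zero), and it is again a
  multiple of a Vandermonde determinant because each column is a polynomial of the right degree.
  Between the two kinds of steps one passes to the complementary set, whose Vandermonde
  product differs by the weight \<open>\<Prod>a. a! (K - a)!\<close>; this is also where the binomial weights
  of the Krawtchouk ensemble come from.
\<close>

section \<open>Vandermonde determinants\<close>

text \<open>The obstacle is that no single description of the squares works on both kinds of
  diagonal: on the black diagonal \<open>2 * r + 1\<close> the count is proportional to the
  Vandermonde product of the \<open>r\<close> squares matched upwards, on the white diagonal
  \<open>2 * r\<close> to that of the \<open>r\<close> squares not matched upwards. From white to
  black the chosen neighbours are already that complement, so no weight appears; from black to white
  the formula moves to the complement before the sum and back after it. The constants are leading
  coefficients: the columns \<open>x ^ j + (x + 1) ^ j\<close> give a factor 2 each, and the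
  weighted columns give the factors \<open>n - j\<close>, of which \<open>1 / fact r\<close>
  survives. The squared Vandermonde product of the ensemble arises because the two sides of a path
  see complementary sets. The value 1/2 of the parameter makes the one-particle weight a binomial
  coefficient times a constant, so only powers of two remain to be compared. The number of all
  tilings is the same count at the last diagonal, so the normalisation needs no separate
  argument.\<close>

lemma det_poly_basis:
  fixes x :: "nat \<Rightarrow> 'a :: idom" and q :: "nat \<Rightarrow> 'a poly"
  assumes "\<And>j. j < r \<Longrightarrow> degree (q j) \<le> j"
  shows "Determinant.det (Matrix.mat r r (\<lambda>(i, j). poly (q j) (x i))) =
    Determinant.det (Matrix.mat r r (\<lambda>(i, j). x i ^ j)) * (\<Prod>j<r. coeff (q j) j)"
proof -
  let ?P = "Matrix.mat r r (\<lambda>(i, j). x i ^ j)"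
  \<comment> \<open>Expanding the columns in powers is multiplication by this coefficient matrix;
    the degree bounds make it upper triangular. A zero diagonal entry is allowed.\<close>
  let ?U = "Matrix.mat r r (\<lambda>(i, j). coeff (q j) i)"
  have 1: "Matrix.mat r r (\<lambda>(i, j). poly (q j) (x i)) = ?P * ?U"
  proof (rule eq_matI; clarsimp simp: scalar_prod_def)
    fix i j assume "i < r" "j < r"
    have "poly (q j) (x i) = (\<Sum>k\<le>j. coeff (q j) k * x i ^ k)"
      using assms[OF \<open>j < r\<close>] unfolding poly_altdef
      by (intro sum.mono_neutral_left) (auto intro: coeff_eq_0)
    also have "\<dots> = (\<Sum>k = 0..<r. coeff (q j) k * x i ^ k)"
    proof (rule sum.mono_neutral_left)
      show "\<forall>k\<in>{0..<r} - {..j}. coeff (q j) k * x i ^ k = 0"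
        using assms[OF \<open>j < r\<close>] by (auto intro: coeff_eq_0)
    qed (use \<open>j < r\<close> in auto)
    finally show "poly (q j) (x i) = (\<Sum>k = 0..<r. x i ^ k * coeff (q j) k)"
      by (simp add: mult.commute)
  qed
  have "Determinant.det ?U = prod_list (diag_mat ?U)"
  proof (rule det_upper_triangular)
    show "upper_triangular ?U"
      using assms by (intro upper_triangularI) (simp add: coeff_eq_0 le_less_trans[OF assms])
  qed (rule mat_carrier)
  also have "\<dots> = (\<Prod>j<r. coeff (q j) j)"
    by (auto simp: prod_list_diag_prod atLeast0LessThan intro!: prod.cong)
  finally show ?thesis
    unfolding 1 by (subst det_mult[of _ r]) auto
qed

lemma det_vandermonde:
  fixes x :: "nat \<Rightarrow> 'a :: idom"
  shows "Determinant.det (Matrix.mat r r (\<lambda>(i, j). x i ^ j)) = (\<Prod>j<r. \<Prod>i<j. x j - x i)"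
proof -
  \<comment> \<open>Newton basis: \<open>q j\<close> vanishes at \<open>x i\<close> for
    \<open>i < j\<close>, so its evaluation matrix is lower triangular, while its leading
    coefficient 1 leaves the determinant unchanged.\<close>
  define q where "q = (\<lambda>j. \<Prod>l<j. [:- x l, 1:])"
  have m: "degree (q j) = j \<and> coeff (q j) j = 1" for j
  proof -
    have "degree (q j) = j"
      unfolding q_def by (subst degree_prod_eq_sum_degree) auto
    moreover have "lead_coeff (q j) = 1"
      unfolding q_def by (subst lead_coeff_prod) auto
    ultimately show ?thesis by simp
  qed
  let ?Q = "Matrix.mat r r (\<lambda>(i, j). poly (q j) (x i))"
  have "Determinant.det ?Q = prod_list (diag_mat ?Q)"
    by (rule det_lower_triangular[of r]) (auto simp: q_def poly_prod)
  also have "\<dots> = (\<Prod>j<r. \<Prod>i<j. x j - x i)"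
    by (auto simp: prod_list_diag_prod atLeast0LessThan q_def poly_prod intro!: prod.cong)
  finally show ?thesis
    using det_poly_basis[of r q x] m by simp
qed

lemma permutes_lessI: "p permutes {..<r} \<Longrightarrow> i < r \<Longrightarrow> p i < r" for r :: nat
  using permutes_in_image[of p "{..<r}" i] by simp

text \<open>Row \<open>i\<close> depends on \<open>f\<close> only through \<open>f i\<close>, so
  multilinearity in the rows moves the sum inside. This needs the sum over all choice functions, not
  only the injective ones.\<close>

lemma sum_det_PiE:
  fixes a :: "nat \<Rightarrow> nat \<Rightarrow> 'b \<Rightarrow> 'a :: comm_ring_1"
  assumes "\<And>i. i < r \<Longrightarrow> finite (S i)"
  shows "(\<Sum>f \<in> PiE {..<r} S. Determinant.det (Matrix.mat r r (\<lambda>(i, j). a i j (f i)))) =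
    Determinant.det (Matrix.mat r r (\<lambda>(i, j). \<Sum>y \<in> S i. a i j y))"
proof -
  let ?P = "{p. p permutes {0..<r}}"
  have "(\<Sum>f \<in> PiE {..<r} S. Determinant.det (Matrix.mat r r (\<lambda>(i, j). a i j (f i)))) =
      (\<Sum>f \<in> PiE {..<r} S. \<Sum>p\<in>?P. signof p * (\<Prod>i<r. a i (p i) (f i)))"
    by (intro sum.cong refl, subst det_def'[of _ r])
      (auto simp: atLeast0LessThan permutes_lessI intro!: sum.cong prod.cong)
  also have "\<dots> = (\<Sum>p\<in>?P. \<Sum>f \<in> PiE {..<r} S. signof p * (\<Prod>i<r. a i (p i) (f i)))"
    by (rule sum.swap)
  also have "\<dots> = (\<Sum>p\<in>?P. signof p * (\<Prod>i<r. \<Sum>y \<in> S i. a i (p i) y))"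
    by (subst prod_sum_PiE) (use assms in \<open>auto simp: sum_distrib_left\<close>)
  also have "\<dots> = Determinant.det (Matrix.mat r r (\<lambda>(i, j). \<Sum>y \<in> S i. a i j y))"
    by (subst det_def'[of _ r])
      (auto simp: atLeast0LessThan permutes_lessI intro!: sum.cong prod.cong)
  finally show ?thesis .
qed

text \<open>Abstract form of one passage between diagonals: \<open>S i\<close> holds the neighbours
  of \<open>x i\<close>. The row factors \<open>c i\<close> come out by scaling and the polynomials
  only contribute their top coefficients.\<close>

lemma sum_PiE_vandermonde:
  fixes x :: "nat \<Rightarrow> real" and g :: "'b \<Rightarrow> real" and w :: "'b \<Rightarrow> real"
  assumes fin: "\<And>i. i < r \<Longrightarrow> finite (S i)"
    and deg: "\<And>j. j < r \<Longrightarrow> degree (q j) \<le> j"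
    and sum: "\<And>i j. i < r \<Longrightarrow> j < r \<Longrightarrow> (\<Sum>y\<in>S i. w y * g y ^ j) = c i * poly (q j) (x i)"
  shows "(\<Sum>f \<in> PiE {..<r} S. (\<Prod>i<r. w (f i)) * (\<Prod>j<r. \<Prod>i<j. g (f j) - g (f i))) =
    (\<Prod>i<r. c i) * (\<Prod>j<r. coeff (q j) j) * (\<Prod>j<r. \<Prod>i<j. x j - x i)"
proof -
  have scale: "Determinant.det (Matrix.mat r r (\<lambda>(i, j). d i * A i j)) =
      (\<Prod>i<r. d i) * Determinant.det (Matrix.mat r r (\<lambda>(i, j). A i j))"
    for d :: "nat \<Rightarrow> real" and A
    by (subst (1 2) det_def'[of _ r])
      (auto simp: atLeast0LessThan permutes_lessI sum_distrib_left prod.distrib mult_ac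
        intro!: sum.cong prod.cong)
  have "(\<Sum>f \<in> PiE {..<r} S. (\<Prod>i<r. w (f i)) * (\<Prod>j<r. \<Prod>i<j. g (f j) - g (f i))) =
      (\<Sum>f \<in> PiE {..<r} S. Determinant.det (Matrix.mat r r (\<lambda>(i, j). w (f i) * g (f i) ^ j)))"
    by (simp add: scale det_vandermonde)
  also have "\<dots> = Determinant.det (Matrix.mat r r (\<lambda>(i, j). \<Sum>y\<in>S i. w y * g y ^ j))"
    by (rule sum_det_PiE[OF fin])
  also have "Matrix.mat r r (\<lambda>(i, j). \<Sum>y\<in>S i. w y * g y ^ j) =
      Matrix.mat r r (\<lambda>(i, j). c i * poly (q j) (x i))"
    by (rule eq_matI) (auto simp: sum)
  also have "Determinant.det \<dots> =
      (\<Prod>i<r. c i) * (\<Prod>j<r. coeff (q j) j) * (\<Prod>j<r. \<Prod>i<j. x j - x i)"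
    by (simp add: scale det_poly_basis[OF deg] det_vandermonde)
  finally show ?thesis .
qed

section \<open>Vandermonde products of finite sets\<close>

text \<open>Differences are taken larger minus smaller, so neither an enumeration nor a sign is
  involved.\<close>

definition vdm :: "nat set \<Rightarrow> real" where
  "vdm A = (\<Prod>b\<in>A. \<Prod>a\<in>{a\<in>A. a < b}. real b - real a)"

text \<open>The superfactorial, Barnes' G at \<open>N + 1\<close>; it is the Vandermonde product of
  an initial segment.\<close>

definition superfact :: "nat \<Rightarrow> real" where
  "superfact N = (\<Prod>j<N. fact j)"

lemma vdm_empty [simp]: "vdm {} = 1"
  by (simp add: vdm_def)

lemma superfact_pos: "superfact N > 0"
  by (auto simp: superfact_def intro!: prod_pos)

lemma vdm_insert:
  assumes "finite A" "x \<notin> A"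
  shows "vdm (insert x A) = vdm A * (\<Prod>a\<in>A. \<bar>real x - real a\<bar>)"
proof -
  have *: "(\<Prod>a\<in>{a\<in>insert x A. a < b}. real b - real a) =
      (if x < b then real b - real x else 1) * (\<Prod>a\<in>{a\<in>A. a < b}. real b - real a)" 
    if "b \<in> A" for b
  proof -
    have "{a\<in>insert x A. a < b} = (if x < b then insert x {a\<in>A. a < b} else {a\<in>A. a < b})"
      by auto
    thus ?thesis using assms by auto
  qed
  have "vdm (insert x A) = (\<Prod>a\<in>{a\<in>insert x A. a < x}. real x - real a) *
      (\<Prod>b\<in>A. \<Prod>a\<in>{a\<in>insert x A. a < b}. real b - real a)"
    using assms by (simp add: vdm_def)
  also have "{a\<in>insert x A. a < x} = {a\<in>A. a < x}" by auto
  also have "(\<Prod>b\<in>A. \<Prod>a\<in>{a\<in>insert x A. a < b}. real b - real a) =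
      (\<Prod>b\<in>A. (if x < b then real b - real x else 1) * (\<Prod>a\<in>{a\<in>A. a < b}. real b - real a))"
    by (intro prod.cong refl *)
  also have "\<dots> = (\<Prod>b\<in>A. if x < b then real b - real x else 1) * vdm A"
    by (simp add: prod.distrib vdm_def)
  also have "(\<Prod>a\<in>{a\<in>A. a < x}. real x - real a) = (\<Prod>a\<in>A. if a < x then real x - real a else 1)"
    using assms by (simp add: prod.inter_filter)
  finally have "vdm (insert x A) = vdm A * (\<Prod>a\<in>A. (if a < x then real x - real a else 1) * 
      (if x < a then real a - real x else 1))"
    by (simp add: prod.distrib mult_ac)
  also have "(\<Prod>a\<in>A. (if a < x then real x - real a else 1) * 
      (if x < a then real a - real x else 1)) = (\<Prod>a\<in>A. \<bar>real x - real a\<bar>)"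
    using assms by (intro prod.cong refl) (auto simp: not_less order_less_le)
  finally show ?thesis .
qed

lemma vdm_image:
  fixes r :: nat
  assumes "strict_mono_on {..<r} t"
  shows "vdm (t ` {..<r}) = (\<Prod>j<r. \<Prod>i<j. real (t j) - real (t i))"
proof -
  have inj: "inj_on t {..<r}"
    using assms by (rule strict_mono_on_imp_inj_on)
  have "{a \<in> t ` {..<r}. a < t j} = t ` {..<j}" if "j < r" for j
  proof -
    have "t i < t j \<longleftrightarrow> i < j" if "i < r" for i
      using strict_mono_on_less[OF assms, of i j] that \<open>j < r\<close> by auto
    thus ?thesis using that by auto
  qed
  moreover have "inj_on t {..<j}" if "j < r" for j
    using inj by (rule inj_on_subset) (use that in auto)
  ultimately show ?thesis
    by (simp add: vdm_def prod.reindex inj)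
qed

lemma abs_diff_prod_lessThan:
  assumes "a < N"
  shows "(\<Prod>x\<in>{..<N} - {a}. \<bar>real a - real x\<bar>) = fact a * fact (N - 1 - a)"
proof -
  have split: "{..<N} - {a} = {..<a} \<union> {a<..<N}" using assms by auto
  have "(\<Prod>x\<in>{..<N} - {a}. \<bar>real a - real x\<bar>) =
      (\<Prod>x<a. \<bar>real a - real x\<bar>) * (\<Prod>x\<in>{a<..<N}. \<bar>real a - real x\<bar>)"
    unfolding split by (rule prod.union_disjoint) auto
  also have "(\<Prod>x<a. \<bar>real a - real x\<bar>) = (\<Prod>x\<in>{1..a}. real x)"
    by (rule prod.reindex_bij_witness[of _ "\<lambda>x. a - x" "\<lambda>x. a - x"]) auto
  also have "(\<Prod>x\<in>{a<..<N}. \<bar>real a - real x\<bar>) = (\<Prod>x\<in>{1..N-1-a}. real x)"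
    by (rule prod.reindex_bij_witness[of _ "\<lambda>x. a + x" "\<lambda>x. x - a"]) auto
  finally show ?thesis by (simp add: fact_prod)
qed

lemma vdm_lessThan: "vdm {..<N} = superfact N"
proof (induction N)
  case 0
  show ?case by (simp add: superfact_def)
next
  case (Suc N)
  have "vdm {..<Suc N} = vdm {..<N} * (\<Prod>x<N. \<bar>real N - real x\<bar>)"
    by (simp add: lessThan_Suc vdm_insert)
  also have "(\<Prod>x<N. \<bar>real N - real x\<bar>) = fact N"
    using abs_diff_prod_lessThan[of N "Suc N"] by (simp add: lessThan_Suc)
  finally show ?case by (simp add: Suc superfact_def)
qed

text \<open>Removing \<open>a\<close> from the complement and adding it to \<open>A\<close> divides by the distances of \<open>a\<close>
  to the rest of the complement and multiplies by those to \<open>A\<close>.\<close>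

lemma vdm_complement:
  assumes "A \<subseteq> {..<N}"
  shows "vdm ({..<N} - A) * (\<Prod>a\<in>A. fact a * fact (N - 1 - a)) = superfact N * vdm A"
proof -
  have "finite A" using assms finite_subset by blast
  thus ?thesis using assms
  proof (induction A)
    case empty
    show ?case by (simp add: vdm_lessThan)
  next
    case (insert x A)
    let ?C = "{..<N} - A" and ?C' = "{..<N} - insert x A"
    have C: "?C = insert x ?C'" using insert by auto
    have "{..<N} - {x} = A \<union> ?C'" using insert by auto
    hence w: "fact x * fact (N - 1 - x) =
        (\<Prod>a\<in>A. \<bar>real x - real a\<bar>) * (\<Prod>a\<in>?C'. \<bar>real x - real a\<bar>)"
      using insert abs_diff_prod_lessThan[of x N]
      by (subst prod.union_disjoint[symmetric]) auto
    have "vdm ?C = vdm ?C' * (\<Prod>a\<in>?C'. \<bar>real x - real a\<bar>)"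
      unfolding C by (rule vdm_insert) auto
    thus ?case using insert w by (simp add: vdm_insert algebra_simps)
  qed
qed

text \<open>Each weight \<open>fact a * fact (N - a)\<close> is \<open>fact N\<close> divided by a
  binomial coefficient. The formula serves both inside the recursion and in the final comparison
  with the ensemble.\<close>

lemma vdm_complement_binomial:
  assumes "A \<subseteq> {..N}"
  shows "vdm ({..N} - A) * fact N ^ card A = superfact (Suc N) * vdm A * (\<Prod>a\<in>A. real (N choose a))"
proof -
  have "real (N choose a) * (fact a * fact (N - a)) = fact N" if "a \<in> A" for a
    using that assms by (subst binomial_fact) auto
  hence "fact N ^ card A = (\<Prod>a\<in>A. fact a * fact (N - a)) * (\<Prod>a\<in>A. real (N choose a))"
    by (simp add: mult.commute flip: prod.distrib)
  hence "vdm ({..N} - A) * fact N ^ card A =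
      vdm ({..N} - A) * (\<Prod>a\<in>A. fact a * fact (N - a)) * (\<Prod>a\<in>A. real (N choose a))"
    by (simp only: mult.assoc)
  also have "vdm ({..N} - A) * (\<Prod>a\<in>A. fact a * fact (N - a)) = superfact (Suc N) * vdm A"
    using vdm_complement[of A "Suc N"] assms by (simp add: lessThan_Suc_atMost)
  finally show ?thesis .
qed

text \<open>Non-injective \<open>f\<close> contribute a vanishing Vandermonde product, so injectivity comes for free.\<close>

lemma sum_vdm_image:
  assumes fin: "\<And>i. i < r \<Longrightarrow> finite (S i)"
    and mono: "\<And>i j x y. i < j \<Longrightarrow> j < r \<Longrightarrow> x \<in> S i \<Longrightarrow> y \<in> S j \<Longrightarrow> x \<le> y"
    and deg: "\<And>j. j < r \<Longrightarrow> degree (q j) \<le> j"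
    and sum: "\<And>i j. i < r \<Longrightarrow> j < r \<Longrightarrow> (\<Sum>y\<in>S i. w y * real y ^ j) = c i * poly (q j) (real (t i))"
    and t: "strict_mono_on {..<r} t"
  shows "(\<Sum>f \<in> {f \<in> PiE {..<r} S. inj_on f {..<r}}. (\<Prod>y\<in>f ` {..<r}. w y) * vdm (f ` {..<r})) =
    (\<Prod>i<r. c i) * (\<Prod>j<r. coeff (q j) j) * vdm (t ` {..<r})"
proof -
  have *: "(\<Prod>y\<in>f ` {..<r}. w y) * vdm (f ` {..<r}) =
      (\<Prod>i<r. w (f i)) * (\<Prod>j<r. \<Prod>i<j. real (f j) - real (f i))"
    if f: "f \<in> PiE {..<r} S" "inj_on f {..<r}" for f
  proof -
    have "strict_mono_on {..<r} f"
    proof (rule strict_mono_onI)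
      fix i j assume ij: "i \<in> {..<r}" "j \<in> {..<r}" "i < j"
      hence "f i \<le> f j" using f by (intro mono[of i j "f i" "f j"]) (auto simp: PiE_def Pi_def)
      moreover have "f i \<noteq> f j" using f(2) ij by (metis inj_onD less_irrefl)
      ultimately show "f i < f j" by simp
    qed
    thus ?thesis using f(2) by (simp add: vdm_image prod.reindex)
  qed
  have "(\<Sum>f \<in> {f \<in> PiE {..<r} S. inj_on f {..<r}}. (\<Prod>y\<in>f ` {..<r}. w y) * vdm (f ` {..<r})) =
      (\<Sum>f \<in> {f \<in> PiE {..<r} S. inj_on f {..<r}}. (\<Prod>i<r. w (f i)) * (\<Prod>j<r. \<Prod>i<j. real (f j) - real (f i)))"
    by (intro sum.cong refl *) auto
  also have "\<dots> = (\<Sum>f \<in> PiE {..<r} S. (\<Prod>i<r. w (f i)) * (\<Prod>j<r. \<Prod>i<j. real (f j) - real (f i)))"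
  proof (rule sum.mono_neutral_left)
    show "finite (PiE {..<r} S)" using fin by (intro finite_PiE) auto
    show "\<forall>f\<in>PiE {..<r} S - {f \<in> PiE {..<r} S. inj_on f {..<r}}.
       (\<Prod>i<r. w (f i)) * (\<Prod>j<r. \<Prod>i<j. real (f j) - real (f i)) = 0"
    proof
      fix f assume "f \<in> PiE {..<r} S - {f \<in> PiE {..<r} S. inj_on f {..<r}}"
      then obtain i j where "i < r" "j < r" "i \<noteq> j" "f i = f j" by (auto simp: inj_on_def)
      then obtain i j where "j < r" "i < j" "f i = f j" by (metis linorder_neqE_nat)
      hence "(\<Prod>i<j. real (f j) - real (f i)) = 0"
        by (intro prod_zero) (auto intro!: bexI[of _ i])
      with \<open>j < r\<close> have "(\<Prod>j<r. \<Prod>i<j. real (f j) - real (f i)) = 0"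
        by (intro prod_zero) auto
      thus "(\<Prod>i<r. w (f i)) * (\<Prod>j<r. \<Prod>i<j. real (f j) - real (f i)) = 0"
        by simp
    qed
  qed auto
  also have "\<dots> = (\<Prod>i<r. c i) * (\<Prod>j<r. coeff (q j) j) * (\<Prod>j<r. \<Prod>i<j. real (t j) - real (t i))"
    by (rule sum_PiE_vandermonde[OF fin deg sum])
  finally show ?thesis by (simp add: vdm_image[OF t])
qed

section \<open>Perfect matchings of the diagonals\<close>

definition perfect_matchings :: "'a set set \<Rightarrow> 'a set \<Rightarrow> 'a set set set" where
  "perfect_matchings E V = {M. M \<subseteq> E \<and> pairwise disjnt M \<and> \<Union>M = V}"

lemma finite_perfect_matchings: "finite V \<Longrightarrow> finite (perfect_matchings E V)"
  by (rule finite_subset[of _ "Pow (Pow V)"]) (auto simp: perfect_matchings_def)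

lemma perfect_matchings_unique:
  "M \<in> perfect_matchings E V \<Longrightarrow> e \<in> M \<Longrightarrow> e' \<in> M \<Longrightarrow> x \<in> e \<Longrightarrow> x \<in> e' \<Longrightarrow> e = e'"
  by (auto simp: perfect_matchings_def pairwise_def disjnt_def)

text \<open>Injectivity is asked on \<open>V\<close> as well, since \<open>V\<close> may contain
  vertices that lie on no edge.\<close>

lemma card_perfect_matchings_image:
  assumes inj: "inj_on f (\<Union>E \<union> V)"
  shows "card (perfect_matchings ((`) f ` E) (f ` V)) = card (perfect_matchings E V)"
proof -
  have inj1: "inj_on ((`) f) (Pow (\<Union>E \<union> V))"
    using inj by (rule inj_on_image_Pow)
  have inj2: "inj_on ((`) ((`) f)) (Pow (Pow (\<Union>E \<union> V)))"
    using inj1 by (rule inj_on_image_Pow)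
  have "(`) ((`) f) ` perfect_matchings E V = perfect_matchings ((`) f ` E) (f ` V)"
  proof (intro equalityI subsetI)
    fix M' assume "M' \<in> (`) ((`) f) ` perfect_matchings E V"
    then obtain M where M: "M \<in> perfect_matchings E V" "M' = (`) f ` M" by auto
    have "disjnt (f ` e) (f ` e')" if "e \<in> M" "e' \<in> M" "f ` e \<noteq> f ` e'" for e e'
    proof -
      have "e \<noteq> e'" using that by auto
      hence "disjnt e e'" using M that by (auto simp: perfect_matchings_def pairwise_def)
      moreover have "e \<subseteq> \<Union>E" "e' \<subseteq> \<Union>E" using M that by (auto simp: perfect_matchings_def)
      ultimately show ?thesis
        using inj by (auto simp: disjnt_def inj_on_def) blast
    qed
    thus "M' \<in> perfect_matchings ((`) f ` E) (f ` V)"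
      using M by (auto simp: perfect_matchings_def pairwise_def)
  next
    fix M' assume M': "M' \<in> perfect_matchings ((`) f ` E) (f ` V)"
    then obtain M where M: "M \<subseteq> E" "M' = (`) f ` M"
      by (auto simp: perfect_matchings_def subset_image_iff)
    have "pairwise disjnt M"
    proof (rule pairwiseI)
      fix e e' assume e: "e \<in> M" "e' \<in> M" "e \<noteq> e'"
      hence "f ` e \<noteq> f ` e'" using inj1 M by (auto simp: inj_on_def)
      hence "disjnt (f ` e) (f ` e')" using M' M e by (auto simp: perfect_matchings_def pairwise_def)
      thus "disjnt e e'" by (auto simp: disjnt_def)
    qed
    moreover have "f ` (\<Union>M) = f ` V"
      using M' M by (simp add: perfect_matchings_def image_Union)
    hence "\<Union>M = V"
      using inj M by (subst (asm) inj_on_image_eq_iff[of f "\<Union>E \<union> V"]) auto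
    ultimately show "M' \<in> (`) ((`) f) ` perfect_matchings E V"
      using M by (auto simp: perfect_matchings_def)
  qed
  moreover have "inj_on ((`) ((`) f)) (perfect_matchings E V)"
    using inj2 by (rule inj_on_subset) (auto simp: perfect_matchings_def)
  ultimately show ?thesis
    by (metis card_image)
qed

text \<open>Once the vertices covered by \<open>E1\<close> are fixed, the two restrictions of a
  matching are independent; disjointness of the edge sets lets them be read off from the
  union.\<close>

lemma card_perfect_matchings_split:
  assumes "E1 \<inter> E2 = {}" "W \<subseteq> V"
  shows "card {M \<in> perfect_matchings (E1 \<union> E2) V. \<Union>(M \<inter> E1) = W} =
    card (perfect_matchings E1 W) * card (perfect_matchings E2 (V - W))"
proof -
  let ?h = "\<lambda>(M1, M2). M1 \<union> M2"
  let ?A = "perfect_matchings E1 W \<times> perfect_matchings E2 (V - W)"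
  have restr: "(M1 \<union> M2) \<inter> E1 = M1" "(M1 \<union> M2) \<inter> E2 = M2"
    if "(M1, M2) \<in> ?A" for M1 M2
    using that assms by (auto simp: perfect_matchings_def)
  have inj: "inj_on ?h ?A"
  proof (rule inj_onI)
    fix p p' assume "p \<in> ?A" "p' \<in> ?A" "?h p = ?h p'"
    thus "p = p'"
      using restr[of "fst p" "snd p"] restr[of "fst p'" "snd p'"]
      by (metis case_prod_beta prod.collapse)
  qed
  have img: "?h ` ?A = {M \<in> perfect_matchings (E1 \<union> E2) V. \<Union>(M \<inter> E1) = W}"
  proof (intro equalityI subsetI)
    fix M assume "M \<in> ?h ` ?A"
    then obtain M1 M2 where M: "(M1, M2) \<in> ?A" "M = M1 \<union> M2" by auto
    have "pairwise disjnt M"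
    proof -
      have "pairwise disjnt M1" "pairwise disjnt M2" "\<Union>M1 = W" "\<Union>M2 = V - W"
        using M(1) by (auto simp: perfect_matchings_def)
      moreover from this have "disjnt e e'" if "e \<in> M1" "e' \<in> M2" for e e'
        using that by (fastforce simp: disjnt_def)
      ultimately show ?thesis unfolding M(2) pairwise_def by (auto simp: disjnt_sym)
    qed
    thus "M \<in> {M \<in> perfect_matchings (E1 \<union> E2) V. \<Union>(M \<inter> E1) = W}"
      using M restr(1)[OF M(1)] assms by (auto simp: perfect_matchings_def)
  next
    fix M assume M: "M \<in> {M \<in> perfect_matchings (E1 \<union> E2) V. \<Union>(M \<inter> E1) = W}"
    have "\<Union>(M \<inter> E2) = V - W"
    proof (intro equalityI subsetI)
      fix x assume "x \<in> \<Union>(M \<inter> E2)"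
      then obtain e where e: "e \<in> M" "e \<in> E2" "x \<in> e" by auto
      have "x \<notin> W"
      proof
        assume "x \<in> W"
        then obtain e' where "e' \<in> M" "e' \<in> E1" "x \<in> e'" using M by blast
        thus False using e M assms perfect_matchings_unique[of M _ V e e' x] by auto
      qed
      thus "x \<in> V - W" using M e by (auto simp: perfect_matchings_def)
    next
      fix x assume "x \<in> V - W"
      thus "x \<in> \<Union>(M \<inter> E2)" using M by (auto simp: perfect_matchings_def)
    qed
    hence "(M \<inter> E1, M \<inter> E2) \<in> ?A"
      using M by (auto simp: perfect_matchings_def pairwise_def)
    moreover have "M = ?h (M \<inter> E1, M \<inter> E2)"
      using M by (auto simp: perfect_matchings_def)
    ultimately show "M \<in> ?h ` ?A" by blast
  qed
  have "card {M \<in> perfect_matchings (E1 \<union> E2) V. \<Union>(M \<inter> E1) = W} = card ?A"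
    using card_image[OF inj] unfolding img .
  thus ?thesis by (simp add: card_cartesian_product)
qed

section \<open>The graph of neighbouring diagonals\<close>

text \<open>The cell \<open>(s, k)\<close> is the \<open>k\<close>-th square of the \<open>s\<close>-th diagonal, counted from the north-east;
  even diagonals \<open>2 * r\<close> are the white ones, odd diagonals \<open>2 * r + 1\<close> the black ones.\<close>

definition diag :: "nat \<Rightarrow> nat \<Rightarrow> nat set" where
  "diag n s = (if even s then {..n} else {..<n})"

text \<open>On either neighbouring diagonal, black square \<open>k\<close> touches the white squares
  \<open>k\<close> and \<open>Suc k\<close>; the two cases are this relation read from its two
  ends.\<close>

definition adj :: "nat \<Rightarrow> nat \<Rightarrow> nat \<Rightarrow> bool" where
  "adj s a b \<longleftrightarrow> (if even s then a = b \<or> a = Suc b else b = a \<or> b = Suc a)"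

definition edges :: "nat \<Rightarrow> nat \<Rightarrow> (nat \<times> nat) set set" where
  "edges n s = {{(s, a), (Suc s, b)} |a b. a \<in> diag n s \<and> b \<in> diag n (Suc s) \<and> adj s a b}"

definition upper_edges :: "nat \<Rightarrow> nat \<Rightarrow> (nat \<times> nat) set set" where
  "upper_edges n s = (\<Union>s'\<in>{1..<s}. edges n s')"

definition lower_edges :: "nat \<Rightarrow> nat \<Rightarrow> (nat \<times> nat) set set" where
  "lower_edges n s = (\<Union>s'\<in>{s..2*n}. edges n s')"

text \<open>All earlier diagonals in full, but of diagonal \<open>s\<close> only \<open>B\<close>:
  the region covered by the dominoes on the upper right of a path.\<close>

definition upper_cells :: "nat \<Rightarrow> nat \<Rightarrow> nat set \<Rightarrow> (nat \<times> nat) set" where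
  "upper_cells n s B = {(s', k). 1 \<le> s' \<and> s' < s \<and> k \<in> diag n s' \<or> s' = s \<and> k \<in> B}"

definition lower_cells :: "nat \<Rightarrow> nat \<Rightarrow> nat set \<Rightarrow> (nat \<times> nat) set" where
  "lower_cells n s B = {(s', k). s < s' \<and> s' \<le> 2*n+1 \<and> k \<in> diag n s' \<or> s' = s \<and> k \<in> B}"

definition upper_count :: "nat \<Rightarrow> nat \<Rightarrow> nat set \<Rightarrow> nat" where
  "upper_count n s B = card (perfect_matchings (upper_edges n s) (upper_cells n s B))"

definition aztec_cells :: "nat \<Rightarrow> (nat \<times> nat) set" where
  "aztec_cells n = {(s, k). 1 \<le> s \<and> s \<le> 2*n+1 \<and> k \<in> diag n s}"

definition aztec_edges :: "nat \<Rightarrow> (nat \<times> nat) set set" where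
  "aztec_edges n = upper_edges n (2*n+1)"

definition covered_above :: "nat \<Rightarrow> (nat \<times> nat) set set \<Rightarrow> nat \<Rightarrow> nat set" where
  "covered_above n M s = {k. (s, k) \<in> \<Union>(M \<inter> upper_edges n s)}"

lemma finite_diag [simp]: "finite (diag n s)"
  by (simp add: diag_def)

lemma finite_aztec_cells: "finite (aztec_cells n)"
proof -
  have "aztec_cells n = (SIGMA s:{1..2*n+1}. diag n s)"
    by (auto simp: aztec_cells_def)
  thus ?thesis by simp
qed

lemma edgesE:
  assumes "e \<in> edges n s"
  obtains a b where "e = {(s, a), (Suc s, b)}" "a \<in> diag n s" "b \<in> diag n (Suc s)" "adj s a b"
  using assms by (auto simp: edges_def)

lemma upper_edges_bound: "e \<in> upper_edges n s \<Longrightarrow> (s', k) \<in> e \<Longrightarrow> 1 \<le> s' \<and> s' \<le> s \<and> k \<in> diag n s'"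
  by (auto simp: upper_edges_def elim!: edgesE)

lemma upper_edges_Suc: "1 \<le> s \<Longrightarrow> upper_edges n (Suc s) = upper_edges n s \<union> edges n s"
  by (auto simp: upper_edges_def atLeastLessThanSuc)

lemma upper_count_one: "upper_count n 1 {} = 1"
proof -
  have "perfect_matchings {} ({} :: (nat \<times> nat) set) = {{}}" by (auto simp: perfect_matchings_def pairwise_def)
  moreover have "upper_cells n 1 {} = {}" by (auto simp: upper_cells_def)
  ultimately show ?thesis by (simp add: upper_count_def upper_edges_def)
qed

lemma upper_count_Suc:
  assumes s: "1 \<le> s" and inj: "inj_on t J" and fin: "finite J" and t: "t ` J \<subseteq> diag n (Suc s)"
  shows "upper_count n (Suc s) (t ` J) =
    (\<Sum>f \<in> {f \<in> PiE J (\<lambda>j. {a \<in> diag n s. adj s a (t j)}). inj_on f J}.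
      upper_count n s (diag n s - f ` J))"
proof -
  let ?F = "{f \<in> PiE J (\<lambda>j. {a \<in> diag n s. adj s a (t j)}). inj_on f J}"
  let ?P = "\<lambda>f. perfect_matchings (upper_edges n s) (upper_cells n s (diag n s - f ` J))"
  let ?V = "upper_cells n (Suc s) (t ` J)"
  let ?Q = "perfect_matchings (upper_edges n (Suc s)) ?V"
  define link where "link = (\<lambda>f. (\<lambda>j. {(s, f j), (Suc s, t j)}) ` J)"
  let ?h = "\<lambda>(f, M). M \<union> link f"
  have finF: "finite ?F"
    by (rule finite_subset[of _ "PiE J (\<lambda>j. {a \<in> diag n s. adj s a (t j)})"])
      (use fin in \<open>auto intro!: finite_PiE\<close>)
  \<comment> \<open>Linking edges reach diagonal \<open>Suc s\<close>, so the upper matching can be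
    recovered by intersecting with \<open>upper_edges n s\<close>.\<close>
  have link: "link f \<inter> upper_edges n s = {}" for f
    using upper_edges_bound by (fastforce simp: link_def)
  have inj_h: "inj_on ?h (Sigma ?F ?P)"
  proof (rule inj_onI, clarify)
    fix f M f' M' assume f: "f \<in> PiE J (\<lambda>j. {a \<in> diag n s. adj s a (t j)})"
      "f' \<in> PiE J (\<lambda>j. {a \<in> diag n s. adj s a (t j)})"
      and M: "M \<in> ?P f" "M' \<in> ?P f'" and eq: "M \<union> link f = M' \<union> link f'"
    have "M \<subseteq> upper_edges n s" "M' \<subseteq> upper_edges n s"
      using M by (auto simp: perfect_matchings_def)
    with eq link[of f] link[of f'] have *: "M = M'" "link f = link f'" by blast+
    have "f j = f' j" if "j \<in> J" for j
    proof -
      have "{(s, f j), (Suc s, t j)} \<in> link f'" using that *(2) by (auto simp: link_def)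
      then obtain j' where "j' \<in> J" "{(s, f j), (Suc s, t j)} = {(s, f' j'), (Suc s, t j')}"
        by (auto simp: link_def)
      thus ?thesis using that inj by (auto simp: doubleton_eq_iff inj_on_def)
    qed
    hence "f = f'" using f by (intro PiE_ext) auto
    thus "f = f' \<and> M = M'" using * by simp
  qed
  have img: "?h ` Sigma ?F ?P = ?Q"
  proof (intro equalityI subsetI)
    fix M' assume "M' \<in> ?h ` Sigma ?F ?P"
    then obtain f M where f: "f \<in> ?F" and M: "M \<in> ?P f" and M': "M' = M \<union> link f" by auto
    have UM: "\<Union>M = upper_cells n s (diag n s - f ` J)" using M by (simp add: perfect_matchings_def)
    have "link f \<subseteq> edges n s"
      using f t by (auto simp: link_def edges_def PiE_def Pi_def)
    hence "M' \<subseteq> upper_edges n (Suc s)"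
      using M M' s by (auto simp: upper_edges_Suc perfect_matchings_def)
    moreover have "pairwise disjnt M'"
    proof -
      have "disjnt e e'" if "e \<in> M" "e' \<in> link f" for e e'
      proof -
        have "e \<subseteq> upper_cells n s (diag n s - f ` J)" using UM that by auto
        moreover have "e' \<inter> upper_cells n s (diag n s - f ` J) = {}"
          using that by (auto simp: link_def upper_cells_def)
        ultimately show ?thesis by (auto simp: disjnt_def)
      qed
      moreover have "pairwise disjnt (link f)"
        using f inj by (auto simp: link_def pairwise_def disjnt_def inj_on_def)
      moreover have "pairwise disjnt M" using M by (simp add: perfect_matchings_def)
      ultimately show ?thesis unfolding M' pairwise_def by (auto simp: disjnt_sym)
    qed
    moreover have "\<Union>M' = ?V"
    proof -
      have fJ: "f ` J \<subseteq> diag n s" using f by (auto simp: PiE_def Pi_def)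
      have "\<Union>(link f) = {s} \<times> f ` J \<union> {Suc s} \<times> t ` J" by (auto simp: link_def)
      hence "\<Union>M' = upper_cells n s (diag n s - f ` J) \<union> ({s} \<times> f ` J \<union> {Suc s} \<times> t ` J)"
        unfolding M' Union_Un_distrib UM by simp
      also have "\<dots> = ?V"
      proof (rule Set.set_eqI, clarify)
        fix a b
        have "b \<in> f ` J \<Longrightarrow> b \<in> diag n s" using fJ by blast
        thus "(a, b) \<in> upper_cells n s (diag n s - f ` J) \<union> ({s} \<times> f ` J \<union> {Suc s} \<times> t ` J) \<longleftrightarrow>
            (a, b) \<in> ?V"
          using s by (cases "b \<in> f ` J") (auto simp: upper_cells_def less_Suc_eq)
      qed
      finally show ?thesis .
    qed
    ultimately show "M' \<in> ?Q" by (simp add: perfect_matchings_def)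
  next
    fix M' assume M': "M' \<in> ?Q"
    note uniq = perfect_matchings_unique[OF M']
    have UM': "\<Union>M' = ?V" and EM': "M' \<subseteq> upper_edges n s \<union> edges n s"
      using M' s by (auto simp: perfect_matchings_def upper_edges_Suc)
    have "\<exists>a. a \<in> diag n s \<and> adj s a (t j) \<and> {(s, a), (Suc s, t j)} \<in> M'" if j: "j \<in> J" for j
    proof -
      have "(Suc s, t j) \<in> \<Union>M'" using UM' j by (auto simp: upper_cells_def)
      then obtain e where e: "e \<in> M'" "(Suc s, t j) \<in> e" by auto
      moreover have "e \<notin> upper_edges n s" using e upper_edges_bound by fastforce
      ultimately have "e \<in> edges n s" using EM' by auto
      thus ?thesis using e by (auto elim!: edgesE)
    qed
    then obtain g where g: "\<And>j. j \<in> J \<Longrightarrow> g j \<in> diag n s \<and> adj s (g j) (t j) \<and> {(s, g j), (Suc s, t j)} \<in> M'"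
      by metis
    \<comment> \<open>Membership in \<open>PiE\<close> demands a fixed value outside
      \<open>J\<close>.\<close>
    define f where "f = restrict g J"
    have f: "f j \<in> diag n s" "adj s (f j) (t j)" "{(s, f j), (Suc s, t j)} \<in> M'" if "j \<in> J" for j
      using g that by (auto simp: f_def)
    have "inj_on f J"
    proof (rule inj_onI)
      fix i j assume ij: "i \<in> J" "j \<in> J" "f i = f j"
      hence "{(s, f i), (Suc s, t i)} = {(s, f j), (Suc s, t j)}"
        by (intro uniq[of _ _ "(s, f i)"] f) auto
      thus "i = j" using ij inj by (auto simp: doubleton_eq_iff inj_on_def)
    qed
    hence fF: "f \<in> ?F" using f by (auto simp: f_def)
    define M where "M = M' \<inter> upper_edges n s"
    have eq: "M' = M \<union> link f"
    proof (intro equalityI subsetI)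
      fix e assume e: "e \<in> M'"
      show "e \<in> M \<union> link f"
      proof (cases "e \<in> upper_edges n s")
        case False
        hence "e \<in> edges n s" using e EM' by auto
        then obtain a b where ab: "e = {(s, a), (Suc s, b)}" by (auto elim!: edgesE)
        have "(Suc s, b) \<in> ?V" using UM' e ab by auto
        then obtain j where j: "j \<in> J" "b = t j" by (auto simp: upper_cells_def)
        have "e = {(s, f j), (Suc s, t j)}"
          using f(3)[OF j(1)] e ab j by (intro uniq[of _ _ "(Suc s, b)"]) auto
        thus ?thesis using j by (auto simp: link_def)
      qed (use e in \<open>auto simp: M_def\<close>)
    qed (use f in \<open>auto simp: M_def link_def\<close>)
    have "\<Union>M = upper_cells n s (diag n s - f ` J)"
    proof (intro equalityI subsetI)
      fix x assume "x \<in> \<Union>M"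
      then obtain e where e: "e \<in> M" "x \<in> e" by auto
      obtain s' k where x: "x = (s', k)" by (cases x)
      have "1 \<le> s' \<and> s' \<le> s \<and> k \<in> diag n s'"
        using e x upper_edges_bound by (auto simp: M_def)
      moreover have "k \<notin> f ` J" if "s' = s"
      proof
        assume "k \<in> f ` J"
        then obtain j where j: "j \<in> J" "k = f j" by auto
        have "e = {(s, f j), (Suc s, t j)}"
          using f(3)[OF j(1)] e x j that by (intro uniq[of _ _ "(s, f j)"]) (auto simp: M_def)
        thus False using e link[of f] j(1) by (auto simp: M_def link_def)
      qed
      ultimately show "x \<in> upper_cells n s (diag n s - f ` J)"
        unfolding x upper_cells_def by auto
    next
      fix x assume x: "x \<in> upper_cells n s (diag n s - f ` J)"
      hence "x \<in> ?V" using s by (auto simp: upper_cells_def)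
      then obtain e where "e \<in> M'" "x \<in> e" using UM' by blast
      moreover have "e \<notin> link f" using x \<open>x \<in> e\<close> by (auto simp: upper_cells_def link_def)
      ultimately show "x \<in> \<Union>M" using eq by auto
    qed
    hence "M \<in> ?P f"
      using M' by (auto simp: perfect_matchings_def M_def pairwise_def)
    hence "(f, M) \<in> Sigma ?F ?P" using fF by blast
    thus "M' \<in> ?h ` Sigma ?F ?P" using eq by (intro image_eqI[of _ _ "(f, M)"]) auto
  qed
  have "card ?Q = card (Sigma ?F ?P)"
    using card_image[OF inj_h] img by simp
  also have "\<dots> = (\<Sum>f\<in>?F. card (?P f))"
  proof (rule card_SigmaI[OF finF], rule ballI)
    fix f
    have "finite (upper_cells n s (diag n s - f ` J))"
      by (rule finite_subset[of _ "{..s} \<times> {..n}"])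
        (auto simp: upper_cells_def diag_def split: if_splits)
    thus "finite (?P f)" by (rule finite_perfect_matchings)
  qed
  finally show ?thesis by (simp add: upper_count_def)
qed

lemma card_lower_matchings:
  assumes s: "1 \<le> s" "s \<le> 2*n+1" and B: "B \<subseteq> diag n s"
  shows "card (perfect_matchings (lower_edges n s) (lower_cells n s B)) = upper_count n (2*n+2-s) B"
proof -
  \<comment> \<open>Reflection in the line \<open>x + y = 0\<close>. It preserves the parity of
    \<open>s\<close>, hence the colour, and the position \<open>k\<close>; the edges between
    \<open>s'\<close> and \<open>Suc s'\<close> go to those between \<open>2*n+1-s'\<close> and its
    successor.\<close>
  let ?f = "\<lambda>(s, k). (2*n+2-s, k :: nat)"
  have par: "diag n (2*n+1-s') = diag n (Suc s')" "diag n (Suc (2*n+1-s')) = diag n s'"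
    "adj (2*n+1-s') b a = adj s' a b" if "s' \<le> 2*n" for s' a b
    using that by (auto simp: diag_def adj_def)
  have edges: "edges n s' = (`) ?f ` edges n (2*n+1-s')" if "1 \<le> s'" "s' \<le> 2*n" for s'
  proof (intro equalityI subsetI)
    fix e assume "e \<in> edges n s'"
    then obtain a b where e: "e = {(s', a), (Suc s', b)}" 
      "a \<in> diag n s'" "b \<in> diag n (Suc s')" "adj s' a b" by (auto elim!: edgesE)
    have "{(2*n+1-s', b), (Suc (2*n+1-s'), a)} \<in> edges n (2*n+1-s')"
      unfolding edges_def using e that by (auto simp only: par mem_Collect_eq)
    moreover have "e = ?f ` {(2*n+1-s', b), (Suc (2*n+1-s'), a)}"
      using that e by (auto simp: Suc_diff_le)
    ultimately show "e \<in> (`) ?f ` edges n (2*n+1-s')" by blast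
  next
    fix e assume "e \<in> (`) ?f ` edges n (2*n+1-s')"
    then obtain a b where e: "e = ?f ` {(2*n+1-s', a), (Suc (2*n+1-s'), b)}"
      and ab: "a \<in> diag n (2*n+1-s')" "b \<in> diag n (Suc (2*n+1-s'))" "adj (2*n+1-s') a b"
      by (auto elim!: edgesE)
    have "e = {(s', b), (Suc s', a)}" using that e by auto
    thus "e \<in> edges n s'"
      unfolding edges_def using ab that by (auto simp only: par mem_Collect_eq)
  qed
  have E: "lower_edges n s = (`) ?f ` upper_edges n (2*n+2-s)"
  proof -
    have "lower_edges n s = (\<Union>s'\<in>{s..2*n}. (`) ?f ` edges n (2*n+1-s'))"
      unfolding lower_edges_def using edges s by (intro SUP_cong) auto
    also have "\<dots> = (`) ?f ` (\<Union>s'\<in>(\<lambda>s'. 2*n+1-s') ` {s..2*n}. edges n s')"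
      by blast
    also have "(\<lambda>s'. 2*n+1-s') ` {s..2*n} = {1..<2*n+2-s}"
    proof (intro equalityI subsetI)
      fix x assume "x \<in> {1..<2*n+2-s}"
      thus "x \<in> (\<lambda>s'. 2*n+1-s') ` {s..2*n}"
        by (intro image_eqI[of _ _ "2*n+1-x"]) auto
    qed (use s in auto)
    finally show ?thesis by (simp add: upper_edges_def)
  qed
  have dg: "diag n (Suc (Suc (2*n)) - s') = diag n s'" if "s' \<le> 2*n+2" for s'
    using that by (simp add: diag_def)
  have C: "lower_cells n s B = ?f ` upper_cells n (2*n+2-s) B"
  proof (intro equalityI subsetI)
    fix x assume "x \<in> lower_cells n s B"
    thus "x \<in> ?f ` upper_cells n (2*n+2-s) B"
      using s by (intro image_eqI[of _ _ "?f x"]) (auto simp: lower_cells_def upper_cells_def dg)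
  qed (use s in \<open>auto simp: lower_cells_def upper_cells_def dg\<close>)
  have "inj_on ?f (\<Union>(upper_edges n (2*n+2-s)) \<union> upper_cells n (2*n+2-s) B)"
  proof (rule inj_onI)
    \<comment> \<open>Truncated subtraction from \<open>2*n+2\<close> is injective only up to that
      value.\<close>
    have bound: "fst x \<le> 2*n+2" 
      if "x \<in> \<Union>(upper_edges n (2*n+2-s)) \<union> upper_cells n (2*n+2-s) B" for x
      using that upper_edges_bound[of _ n "2*n+2-s" "fst x" "snd x"]
      by (fastforce simp: upper_cells_def)
    fix x y assume "x \<in> \<Union>(upper_edges n (2*n+2-s)) \<union> upper_cells n (2*n+2-s) B"
      "y \<in> \<Union>(upper_edges n (2*n+2-s)) \<union> upper_cells n (2*n+2-s) B" "?f x = ?f y"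
    thus "x = y" using bound[of x] bound[of y] by (cases x; cases y) auto
  qed
  thus ?thesis
    unfolding E C upper_count_def by (rule card_perfect_matchings_image)
qed

lemma aztec_edges_split:
  assumes "1 \<le> s" "s \<le> 2*n+1"
  shows "aztec_edges n = upper_edges n s \<union> lower_edges n s" "upper_edges n s \<inter> lower_edges n s = {}"
proof -
  have "{1..<2*n+1} = {1..<s} \<union> {s..2*n}" using assms by auto
  thus "aztec_edges n = upper_edges n s \<union> lower_edges n s"
    by (auto simp: aztec_edges_def upper_edges_def lower_edges_def)
  show "upper_edges n s \<inter> lower_edges n s = {}"
    by (auto simp: upper_edges_def lower_edges_def doubleton_eq_iff elim!: edgesE)
qed

text \<open>Lower edges never touch the diagonals before \<open>s\<close>, so these are covered by
  upper edges in any case and only the trace on diagonal \<open>s\<close> can vary.\<close>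

lemma covered_above_eq_iff:
  assumes "1 \<le> s" "s \<le> 2*n+1" and M: "M \<in> perfect_matchings (aztec_edges n) (aztec_cells n)"
  shows "\<Union>(M \<inter> upper_edges n s) = upper_cells n s B \<longleftrightarrow> covered_above n M s = B"
proof -
  have "\<Union>(M \<inter> upper_edges n s) = upper_cells n s (covered_above n M s)"
  proof (intro equalityI subsetI)
    fix x assume "x \<in> \<Union>(M \<inter> upper_edges n s)"
    thus "x \<in> upper_cells n s (covered_above n M s)"
      using upper_edges_bound by (cases x) (fastforce simp: upper_cells_def covered_above_def)
  next
    fix x assume x: "x \<in> upper_cells n s (covered_above n M s)"
    show "x \<in> \<Union>(M \<inter> upper_edges n s)"
    proof (cases "fst x = s")
      case True
      thus ?thesis using x by (auto simp: upper_cells_def covered_above_def)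
    next
      case False
      hence *: "1 \<le> fst x" "fst x < s" "x \<in> aztec_cells n"
        using x assms by (auto simp: upper_cells_def aztec_cells_def)
      then obtain e where e: "e \<in> M" "x \<in> e"
        using M by (auto simp: perfect_matchings_def)
      moreover have "e \<notin> lower_edges n s"
        using e * by (auto simp: lower_edges_def elim!: edgesE)
      ultimately show ?thesis
        using M aztec_edges_split(1)[OF assms(1,2)] by (auto simp: perfect_matchings_def)
    qed
  qed
  thus ?thesis by (auto simp: upper_cells_def set_eq_iff)
qed

text \<open>Squares of diagonal \<open>s\<close> outside \<open>B\<close> must be matched downwards,
  whence the complement in the second factor, which is a reflected lower count.\<close>

lemma card_covered_above:
  assumes s: "1 \<le> s" "s \<le> 2*n+1" and B: "B \<subseteq> diag n s"
  shows "card {M \<in> perfect_matchings (aztec_edges n) (aztec_cells n). covered_above n M s = B} =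
    upper_count n s B * upper_count n (2*n+2-s) (diag n s - B)"
proof -
  have sub: "upper_cells n s B \<subseteq> aztec_cells n"
    using assms by (auto simp: upper_cells_def aztec_cells_def)
  have diff: "aztec_cells n - upper_cells n s B = lower_cells n s (diag n s - B)"
    using assms by (auto simp: upper_cells_def lower_cells_def aztec_cells_def)
  have "{M \<in> perfect_matchings (aztec_edges n) (aztec_cells n). covered_above n M s = B} =
      {M \<in> perfect_matchings (aztec_edges n) (aztec_cells n).
        \<Union>(M \<inter> upper_edges n s) = upper_cells n s B}"
    using covered_above_eq_iff[OF s] by blast
  also have "card \<dots> = card (perfect_matchings (upper_edges n s) (upper_cells n s B)) *
      card (perfect_matchings (lower_edges n s) (lower_cells n s (diag n s - B)))"
    unfolding aztec_edges_split(1)[OF s] diff[symmetric]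
    by (rule card_perfect_matchings_split[OF aztec_edges_split(2)[OF s] sub])
  finally show ?thesis
    using card_lower_matchings[OF s _, of "diag n s - B"] by (simp add: upper_count_def)
qed

text \<open>Below the last diagonal there is nothing, so all of it is matched upwards.\<close>

lemma card_aztec_matchings:
  "card (perfect_matchings (aztec_edges n) (aztec_cells n)) = upper_count n (2*n+1) (diag n (2*n+1))"
proof -
  have "aztec_cells n = upper_cells n (2*n+1) (diag n (2*n+1))"
    by (auto simp: aztec_cells_def upper_cells_def order.order_iff_strict)
  thus ?thesis by (simp add: upper_count_def aztec_edges_def)
qed

section \<open>Counting the matchings above a diagonal\<close>

lemma obtain_enumeration:
  fixes A :: "nat set"
  assumes "finite A"
  obtains t where "strict_mono_on {..<card A} t" "t ` {..<card A} = A"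
proof -
  obtain t where t: "strict_mono_on {..<card A} t" "\<forall>i<card A. t i \<in> A"
    using finite_enumerate[OF assms] by blast
  have "card (t ` {..<card A}) = card A"
    using t(1) by (simp add: card_image strict_mono_on_imp_inj_on)
  hence "t ` {..<card A} = A"
    using t(2) assms by (intro card_subset_eq) auto
  thus ?thesis using t that by blast
qed

text \<open>Both summands have degree \<open>j + 1\<close>, but their leading terms cancel. In
  degree \<open>j\<close> there remain \<open>c\<close> and the second coefficient \<open>-j\<close>
  of the power of \<open>x - 1\<close>.\<close>

lemma poly_shift_coeffs:
  fixes c :: real
  defines "q \<equiv> (\<lambda>j. ([:c, -1:] * [:0, 1:] ^ j + [:0, 1:] * [:-1, 1:] ^ j))"
  shows "degree (q j) \<le> j" "coeff (q j) j = c - j"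
proof -
  have mon: "[:0, 1:] ^ j = monom (1 :: real) j"
    by (simp add: monom_altdef)
  have 0: "coeff ([:0, 1:] ^ j) i = (if i = j then 1 else (0::real))" for i
    unfolding mon by simp
  have deg1: "degree ([:-1, 1:] ^ j :: real poly) = j"
    by (simp add: degree_power_eq)
  have top: "coeff ([:-1, 1:] ^ j) j = (1::real)"
    by (rule coeff_linear_power)
  have sub: "coeff ([:-1, 1:] ^ j) (j - 1) = - real j" if "j > 0"
    using that binomial_symmetric[of 1 j] by (subst coeff_linear_poly_power) auto
  have coeff: "coeff (q j) i = c * coeff ([:0, 1:] ^ j) i - (case i of 0 \<Rightarrow> 0 | Suc k \<Rightarrow> coeff ([:0, 1:] ^ j) k)
      + (case i of 0 \<Rightarrow> 0 | Suc k \<Rightarrow> coeff ([:-1, 1:] ^ j) k)" for i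
    by (auto simp: q_def coeff_pCons split: nat.splits)
  show "degree (q j) \<le> j"
  proof (rule degree_le, intro allI impI)
    fix i assume "j < i"
    then obtain k where i: "i = Suc k" "j \<le> k" by (cases i) auto
    show "coeff (q j) i = 0"
    proof (cases "k = j")
      case False
      hence "coeff ([:-1, 1:] ^ j) k = (0::real)"
        using i deg1 by (intro coeff_eq_0) auto
      thus ?thesis using i False unfolding coeff 0 by simp
    qed (use i in \<open>simp add: coeff 0 top\<close>)
  qed
  show "coeff (q j) j = c - j"
    unfolding coeff 0 using sub by (cases j) (auto simp del: power_Suc)
qed

text \<open>Every black square has both white neighbours, \<open>t j\<close> and
  \<open>Suc (t j)\<close>, so the columns are \<open>x ^ j + (x + 1) ^ j\<close> with top
  coefficient 2, also for \<open>j = 0\<close>. The hypothesis on \<open>B\<close> already speaks of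
  the complement, which is the image of \<open>f\<close>.\<close>

lemma upper_count_white_step:
  assumes r: "1 \<le> r" "r \<le> n" and T: "T \<subseteq> {..<n}" "card T = r"
    and IH: "\<And>B. B \<subseteq> {..n} \<Longrightarrow> card B = n + 1 - r \<Longrightarrow>
      real (upper_count n (2*r) B) = C * vdm ({..n} - B)"
  shows "real (upper_count n (2*r+1) T) = C * 2 ^ r * vdm T"
proof -
  have "finite T" using T(1) finite_subset by blast
  then obtain t where t: "strict_mono_on {..<r} t" "t ` {..<r} = T"
    using obtain_enumeration T(2) by blast
  have tn: "t j < n" if "j < r" for j using t T that by auto
  define S where "S = (\<lambda>j. {t j, Suc (t j)})"
  let ?F = "{f \<in> PiE {..<r} S. inj_on f {..<r}}"
  have F: "{f \<in> PiE {..<r} (\<lambda>j. {a \<in> diag n (2*r). adj (2*r) a (t j)}). inj_on f {..<r}} = ?F"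
  proof -
    have "PiE {..<r} (\<lambda>j. {a \<in> diag n (2*r). adj (2*r) a (t j)}) = PiE {..<r} S"
      using tn by (intro PiE_cong) (fastforce simp: diag_def adj_def S_def)
    thus ?thesis by simp
  qed
  have "real (upper_count n (2*r+1) T) =
      (\<Sum>f\<in>?F. real (upper_count n (2*r) (diag n (2*r) - f ` {..<r})))"
    using upper_count_Suc[of "2*r" t "{..<r}" n] r T t F
    by (simp add: strict_mono_on_imp_inj_on diag_def)
  also have "\<dots> = (\<Sum>f\<in>?F. C * ((\<Prod>y\<in>f ` {..<r}. 1) * vdm (f ` {..<r})))"
  proof (intro sum.cong refl)
    fix f assume f: "f \<in> ?F"
    have sub: "f ` {..<r} \<subseteq> {..n}" using f tn by (fastforce simp: S_def PiE_def Pi_def)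
    moreover have "card (f ` {..<r}) = r" using f by (simp add: card_image)
    ultimately have "card ({..n} - f ` {..<r}) = n + 1 - r"
      by (subst card_Diff_subset) auto
    hence "real (upper_count n (2*r) ({..n} - f ` {..<r})) = C * vdm ({..n} - ({..n} - f ` {..<r}))"
      by (intro IH) auto
    also have "{..n} - ({..n} - f ` {..<r}) = f ` {..<r}" using sub by auto
    finally show "real (upper_count n (2*r) (diag n (2*r) - f ` {..<r})) =
        C * ((\<Prod>y\<in>f ` {..<r}. 1) * vdm (f ` {..<r}))"
      by (simp add: diag_def)
  qed
  also have "\<dots> = C * (\<Sum>f\<in>?F. (\<Prod>y\<in>f ` {..<r}. 1) * vdm (f ` {..<r}))"
    by (simp add: sum_distrib_left)
  also have "(\<Sum>f\<in>?F. (\<Prod>y\<in>f ` {..<r}. 1) * vdm (f ` {..<r})) =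
      (\<Prod>i<r. 1) * (\<Prod>j<r. coeff ([:0, 1:] ^ j + [:1, 1:] ^ j) j) * vdm (t ` {..<r})"
  proof (rule sum_vdm_image)
    fix i j x y assume *: "i < j" "j < r" "x \<in> S i" "y \<in> S j"
    \<comment> \<open>Strict increase gives \<open>Suc (t i) \<le> t j\<close>: choices are weakly
      ordered, and ties are the non-injective ones.\<close>
    hence "t i < t j" using t(1) by (auto simp: strict_mono_on_def)
    thus "x \<le> y" using * by (auto simp: S_def)
  next
    fix j
    show "degree ([:0, 1:] ^ j + [:1, 1:] ^ j :: real poly) \<le> j"
      by (rule degree_add_le) (simp_all add: degree_power_eq)
  qed (use t in \<open>auto simp: S_def add.commute\<close>)
  also have "(\<Prod>j<r. coeff ([:0, 1:] ^ j + [:1, 1:] ^ j) j) = (2::real) ^ r"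
    by (simp add: coeff_linear_power)
  finally show ?thesis using t by simp
qed

text \<open>The weights of the two neighbours share the factor \<open>(n choose k) / n\<close>,
  which becomes the row factor; the remaining factors are linear in \<open>k\<close> and keep the
  columns polynomial.\<close>

lemma binomial_pred:
  assumes "1 \<le> n" "k \<le> n"
  shows "real (n - 1 choose k) = real (n choose k) * (real n - real k) / n"
    and "1 \<le> k \<Longrightarrow> real (n - 1 choose (k - 1)) = real (n choose k) * real k / n"
proof -
  show *: "real (n - 1 choose (k - 1)) = real (n choose k) * real k / n" if "1 \<le> k"
  proof -
    have "k * (n choose k) = n * (n - 1 choose (k - 1))"
      using that by (intro times_binomial_minus1_eq) simp
    hence "real k * real (n choose k) = real n * real (n - 1 choose (k - 1))"
      by (metis of_nat_mult)
    thus ?thesis using assms by (simp add: field_simps)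
  qed
  show "real (n - 1 choose k) = real (n choose k) * (real n - real k) / n"
  proof (cases "k = 0")
    case False
    hence "n choose k = (n - 1 choose (k - 1)) + (n - 1 choose k)"
      using assms by (intro choose_reduce_nat) auto
    hence "real (n - 1 choose k) = real (n choose k) - real (n choose k) * real k / n"
      using * False by simp
    thus ?thesis using assms by (simp add: field_simps)
  qed (use assms in auto)
qed

lemma prod_falling: "m \<le> n \<Longrightarrow> (\<Prod>j<m. real (n - j)) = fact n / fact (n - m)"
proof (induction m)
  case (Suc m)
  hence "n - m = Suc (n - Suc m)" by simp
  hence "fact (n - m) = real (n - m) * fact (n - Suc m)" by (metis fact_Suc of_nat_mult of_nat_fact)
  thus ?case using Suc by simp
qed simp

text \<open>In terms of the Vandermonde product of the complement, the sum carries the weights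
  \<open>n - 1 choose a\<close>; they turn the two admissible neighbours of \<open>b\<close> into
  \<open>(n choose b) / n * ((n - b) * b ^ j + b * (b - 1) ^ j)\<close>, which is also correct at the two
  ends \<open>b = 0\<close> and \<open>b = n\<close>, where one neighbour is missing.\<close>

lemma upper_count_black_step:
  assumes r: "r < n" and B: "B \<subseteq> {..n}" "card B = n - r"
    and IH: "\<And>T. T \<subseteq> {..<n} \<Longrightarrow> card T = r \<Longrightarrow> real (upper_count n (2*r+1) T) = C * vdm T"
  shows "real (upper_count n (2*r+2) B) = C / fact r * vdm ({..n} - B)"
proof -
  define m where "m = n - r"
  have "finite B" using B(1) finite_subset by blast
  then obtain t where t: "strict_mono_on {..<m} t" "t ` {..<m} = B"
    using obtain_enumeration B(2) m_def by metis
  have inj: "inj_on t {..<m}" using t by (simp add: strict_mono_on_imp_inj_on)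
  have tn: "t j \<le> n" if "j < m" for j using t B that by auto
  define S where "S = (\<lambda>j. {a. a < n \<and> (a = t j \<or> Suc a = t j)})"
  define w where "w = (\<lambda>a. real (n - 1 choose a))"
  let ?F = "{f \<in> PiE {..<m} S. inj_on f {..<m}}"
  let ?q = "\<lambda>j. [:real n, -1:] * [:0, 1:] ^ j + [:0, 1:] * [:-1, 1:] ^ j"
  let ?P = "\<lambda>f. (\<Prod>y\<in>f ` {..<m}. w y) * vdm (f ` {..<m})"
  have F: "{f \<in> PiE {..<m} (\<lambda>j. {a \<in> diag n (2*r+1). adj (2*r+1) a (t j)}). inj_on f {..<m}} = ?F"
  proof -
    have "PiE {..<m} (\<lambda>j. {a \<in> diag n (2*r+1). adj (2*r+1) a (t j)}) = PiE {..<m} S"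
      by (intro PiE_cong) (auto simp: diag_def adj_def S_def)
    thus ?thesis by simp
  qed
  have "real (upper_count n (2*r+2) B) =
      (\<Sum>f\<in>?F. real (upper_count n (2*r+1) (diag n (2*r+1) - f ` {..<m})))"
    using upper_count_Suc[of "2*r+1" t "{..<m}" n] B t F inj by (simp add: diag_def)
  \<comment> \<open>The hypothesis concerns the squares that \<open>f\<close> leaves over; the
    complement formula in \<open>{..n - 1}\<close> passes to the chosen ones, at the price of this
    constant.\<close>
  also have "\<dots> = (\<Sum>f\<in>?F. C * superfact n / fact (n - 1) ^ m * ?P f)"
  proof (intro sum.cong refl)
    fix f assume f: "f \<in> ?F"
    have sub: "f ` {..<m} \<subseteq> {..<n}" using f by (fastforce simp: S_def PiE_def Pi_def)
    have card: "card (f ` {..<m}) = m" using f by (simp add: card_image)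
    with sub have "card ({..<n} - f ` {..<m}) = r"
      using r by (subst card_Diff_subset) (auto simp: m_def)
    hence "real (upper_count n (2*r+1) ({..<n} - f ` {..<m})) = C * vdm ({..<n} - f ` {..<m})"
      by (intro IH) auto
    moreover have "{..<n} = {..n - 1}" using r by auto
    hence "vdm ({..<n} - f ` {..<m}) * fact (n - 1) ^ m = superfact n * ?P f"
      using vdm_complement_binomial[of "f ` {..<m}" "n - 1"] sub card r
      by (simp add: w_def mult_ac)
    ultimately show "real (upper_count n (2*r+1) (diag n (2*r+1) - f ` {..<m})) =
        C * superfact n / fact (n - 1) ^ m * ?P f"
      by (simp add: diag_def field_simps)
  qed
  also have "\<dots> = C * superfact n / fact (n - 1) ^ m * (\<Sum>f\<in>?F. ?P f)"
    by (simp only: sum_distrib_left)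
  also have "(\<Sum>f\<in>?F. ?P f) = (\<Prod>i<m. real (n choose t i) / n) * (\<Prod>j<m. coeff (?q j) j) * vdm (t ` {..<m})"
  proof (rule sum_vdm_image)
    fix i j x y assume *: "i < j" "j < m" "x \<in> S i" "y \<in> S j"
    hence "t i < t j" using t(1) by (auto simp: strict_mono_on_def)
    thus "x \<le> y" using * by (auto simp: S_def)
  next
    fix j
    show "degree (?q j) \<le> j" by (rule poly_shift_coeffs)
  next
    fix i j assume ij: "i < m" "j < m"
    let ?b = "t i"
    have Sb: "S i = {a. a = ?b \<and> ?b < n} \<union> {a. Suc a = ?b}" using tn[OF ij(1)] by (auto simp: S_def)
    have "(\<Sum>y\<in>S i. w y * real y ^ j) =
        (\<Sum>y\<in>{a. a = ?b \<and> ?b < n}. w y * real y ^ j) + (\<Sum>y\<in>{a. Suc a = ?b}. w y * real y ^ j)"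
      unfolding Sb by (rule sum.union_disjoint) (auto intro: finite_subset[of _ "{..?b}"])
    also have "(\<Sum>y\<in>{a. a = ?b \<and> ?b < n}. w y * real y ^ j) =
        real (n choose ?b) * (real n - real ?b) / n * real ?b ^ j"
    proof (cases "?b < n")
      case True
      hence "{a. a = ?b \<and> ?b < n} = {?b}" by auto
      thus ?thesis using binomial_pred(1)[of n ?b] True by (simp add: w_def)
    qed (use tn[OF ij(1)] in auto)
    also have "(\<Sum>y\<in>{a. Suc a = ?b}. w y * real y ^ j) =
        real (n choose ?b) * real ?b / n * (real ?b - 1) ^ j"
    proof (cases "?b = 0")
      case False
      hence "{a. Suc a = ?b} = {?b - 1}" by auto
      thus ?thesis using binomial_pred(2)[of n ?b] False tn[OF ij(1)] r
        by (simp add: w_def of_nat_diff)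
    qed auto
    finally show "(\<Sum>y\<in>S i. w y * real y ^ j) = real (n choose ?b) / n * poly (?q j) (real ?b)"
      by (simp add: algebra_simps add_divide_distrib diff_divide_distrib)
  qed (use t in \<open>auto simp: S_def\<close>)
  also have "(\<Prod>j<m. coeff (?q j) j) = fact n / fact r"
  proof -
    have "(\<Prod>j<m. coeff (?q j) j) = (\<Prod>j<m. real (n - j))"
      unfolding poly_shift_coeffs by (intro prod.cong) (auto simp: m_def)
    also have "\<dots> = fact n / fact (n - m)"
      by (rule prod_falling) (simp add: m_def)
    finally show ?thesis using r by (simp add: m_def)
  qed
  also have "(\<Prod>i<m. real (n choose t i) / n) = (\<Prod>b\<in>B. real (n choose b)) / n ^ m"
    using t(2) inj by (simp add: prod_dividef prod.reindex flip: t(2))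
  finally have "real (upper_count n (2*r+2) B) = 
     C * superfact n / (fact (n - 1) ^ m * real n ^ m) * (fact n / fact r) * 
      (vdm B * (\<Prod>b\<in>B. real (n choose b)))"
    using t(2) by (simp add: mult_ac)
  \<comment> \<open>Back to the complement, now in \<open>{..n}\<close>. The powers of
    \<open>fact n\<close> and the superfactorials cancel, so that only \<open>1 / fact r\<close> is
    left.\<close>
  also have "vdm B * (\<Prod>b\<in>B. real (n choose b)) = vdm ({..n} - B) * fact n ^ m / superfact (Suc n)"
    using vdm_complement_binomial[OF B(1)] B(2) superfact_pos[of "Suc n"] 
    by (simp add: field_simps m_def)
  also have "fact (n - 1) ^ m * real n ^ m = fact n ^ m"
    using r by (subst fact_reduce[of n]) (auto simp: power_mult_distrib mult_ac)
  also have "superfact (Suc n) = superfact n * fact n"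
    by (simp add: superfact_def)
  finally show ?thesis
    using superfact_pos[of n] by (simp add: field_simps)
qed

text \<open>Joint induction alternating the two steps: the factors \<open>2 ^ r\<close> accumulate
  to triangular exponents and the factors \<open>1 / fact r\<close> to the superfactorial.\<close>

lemma
  shows upper_count_black: "\<And>T. r \<le> n \<Longrightarrow> T \<subseteq> {..<n} \<Longrightarrow> card T = r \<Longrightarrow>
      real (upper_count n (2*r+1) T) = 2 ^ (r * (r + 1) div 2) / superfact r * vdm T"
    and upper_count_white: "\<And>B. 1 \<le> r \<Longrightarrow> r \<le> n \<Longrightarrow> B \<subseteq> {..n} \<Longrightarrow> card B = n + 1 - r \<Longrightarrow>
      real (upper_count n (2*r) B) = 2 ^ (r * (r - 1) div 2) / superfact r * vdm ({..n} - B)"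
proof (induction r)
  case 0
  {
    case 1
    hence "T = {}" using finite_subset[of T "{..<n}"] by simp
    thus ?case using upper_count_one by (simp add: superfact_def)
  next
    case 2
    thus ?case by simp
  }
next
  case (Suc r)
  \<comment> \<open>The white formula for \<open>Suc r\<close> needs only the black one for
    \<open>r\<close>, and the black one for \<open>Suc r\<close> then needs this white one.\<close>
  have W: "real (upper_count n (2 * Suc r) B) = 
      2 ^ (Suc r * (Suc r - 1) div 2) / superfact (Suc r) * vdm ({..n} - B)"
    if "Suc r \<le> n" "B \<subseteq> {..n}" "card B = n + 1 - Suc r" for B
    using upper_count_black_step[of r n B "2 ^ (r * (r + 1) div 2) / superfact r"] Suc.IH(1) that
    by (simp add: superfact_def mult_ac)
  {
    case 1
    have "2 ^ (Suc r * (Suc r - 1) div 2) * 2 ^ Suc r = (2::real) ^ (Suc r * (Suc r + 1) div 2)"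
      unfolding power_add[symmetric] by (rule arg_cong[of _ _ "\<lambda>x. 2 ^ x"]) simp
    thus ?case
      using upper_count_white_step[of "Suc r" n T "2 ^ (Suc r * (Suc r - 1) div 2) / superfact (Suc r)"] 1 W
      by (simp del: power_Suc add: mult_ac)
  next
    case 2
    thus ?case using W by blast
  }
qed

section \<open>The Krawtchouk weight\<close>

text \<open>The particles come in arbitrary order; squaring removes the signs, so only the set of
  positions matters.\<close>

lemma vdm_image_squared:
  fixes h :: "nat \<Rightarrow> nat"
  assumes "inj_on h {1..N}"
  shows "(\<Prod>(i, j) \<in> {(i, j). 1 \<le> i \<and> i < j \<and> j \<le> N}. (real (h j) - real (h i))\<^sup>2) =
    (vdm (h ` {1..N}))\<^sup>2"
  using assms
proof (induction N)
  case 0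
  have "{(i, j). 1 \<le> i \<and> i < j \<and> j \<le> (0::nat)} = {}" by auto
  thus ?case by (simp only:) simp
next
  case (Suc N)
  let ?P = "\<lambda>N. {(i, j). 1 \<le> i \<and> i < j \<and> j \<le> (N::nat)}"
  have fin: "finite (?P N)" by (rule finite_subset[of _ "{..N} \<times> {..N}"]) auto
  have split: "?P (Suc N) = ?P N \<union> (\<lambda>i. (i, Suc N)) ` {1..N}" by (auto simp: le_Suc_eq)
  have "(\<Prod>(i, j) \<in> ?P (Suc N). (real (h j) - real (h i))\<^sup>2) =
      (\<Prod>(i, j) \<in> ?P N. (real (h j) - real (h i))\<^sup>2) *
      (\<Prod>(i, j) \<in> (\<lambda>i. (i, Suc N)) ` {1..N}. (real (h j) - real (h i))\<^sup>2)"
    unfolding split by (rule prod.union_disjoint) (use fin in auto)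
  also have "(\<Prod>(i, j) \<in> (\<lambda>i. (i, Suc N)) ` {1..N}. (real (h j) - real (h i))\<^sup>2) =
      (\<Prod>i\<in>{1..N}. (real (h (Suc N)) - real (h i))\<^sup>2)"
    by (subst prod.reindex) (auto simp: inj_on_def)
  also have "\<dots> = (\<Prod>a\<in>h ` {1..N}. \<bar>real (h (Suc N)) - real a\<bar>)\<^sup>2"
    using Suc.prems by (subst prod.reindex) (auto simp: inj_on_def prod_power_distrib)
  also have "(\<Prod>(i, j) \<in> ?P N. (real (h j) - real (h i))\<^sup>2) = (vdm (h ` {1..N}))\<^sup>2"
    using Suc.prems by (intro Suc.IH) (auto simp: inj_on_def)
  also have "\<dots> * (\<Prod>a\<in>h ` {1..N}. \<bar>real (h (Suc N)) - real a\<bar>)\<^sup>2 =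
      (vdm (insert (h (Suc N)) (h ` {1..N})))\<^sup>2"
    using Suc.prems by (subst vdm_insert) (force simp: power_mult_distrib inj_on_def)+
  also have "insert (h (Suc N)) (h ` {1..N}) = h ` {1..Suc N}"
    by (simp add: atLeastAtMostSuc_conv)
  finally show ?case .
qed

text \<open>The \<open>r\<close> largest factorials are the denominators in
  \<open>krawtchouk_Z\<close>.\<close>

lemma superfact_split:
  "r \<le> Suc K \<Longrightarrow> superfact (Suc K) = superfact (Suc K - r) * (\<Prod>j<r. fact (K - j))"
proof (induction r)
  case (Suc r)
  hence "Suc K - r = Suc (K - r)" by simp
  thus ?case using Suc by (simp add: superfact_def)
qed simp

text \<open>The exponents are left abstract to serve both colours. In \<open>e\<close>, each
  particle contributes \<open>K\<close> through its weight, \<open>r * (r - 1)\<close> comes from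
  the powers of 1/4 in the normalisation, \<open>e1\<close> and \<open>e2\<close> belong to the two
  sides of the path and \<open>2 ^ e\<close> will be the number of tilings.\<close>

lemma krawtchouk_half:
  assumes h: "inj_on h {1..r}" "h ` {1..r} \<subseteq> {..K}" and r: "r \<le> Suc K"
    and e: "e1 + e2 + K * r = e + r * (r - 1)"
  shows "fact r * krawtchouk r K (1/2) h =
    (2 ^ e1 / superfact r * vdm (h ` {1..r})) *
    (2 ^ e2 / superfact (Suc K - r) * vdm ({..K} - h ` {1..r})) / 2 ^ e"
proof -
  define H where "H = h ` {1..r}"
  define F :: real where "F = (\<Prod>j<r. fact (K - j))"
  have cardH: "card H = r" using h(1) by (simp add: H_def card_image)
  have F: "F > 0" unfolding F_def by (auto intro!: prod_pos)
  note pos = F superfact_pos[of r] superfact_pos[of "Suc K - r"]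
  have "(\<Prod>j<r. fact j / fact (K - j)) = superfact r / F"
    by (simp add: superfact_def F_def prod_dividef)
  hence Z: "krawtchouk_Z r K (1/2) = fact r * (superfact r / F) * fact K ^ r / 2 ^ (r * (r - 1))"
  proof -
    have "even (r * (r - 1))" by (cases r) auto
    then obtain k where k: "r * (r - 1) = 2 * k" by (elim evenE)
    have "(1/4::real) ^ (r * (r - 1) div 2) = 1 / 2 ^ (r * (r - 1))"
      unfolding k by (simp add: power_mult power_one_over)
    thus ?thesis using \<open>_ = superfact r / F\<close> by (simp add: krawtchouk_Z_def)
  qed
  have P: "(\<Prod>j = 1..r. real (K choose h j) * (1/2) ^ h j * (1 - 1/2) ^ (K - h j)) =
      (\<Prod>a\<in>H. real (K choose a)) / 2 ^ (K * r)"
  proof -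
    have "(\<Prod>j = 1..r. real (K choose h j) * (1/2) ^ h j * (1 - 1/2) ^ (K - h j)) =
        (\<Prod>j = 1..r. real (K choose h j) / 2 ^ K)"
    proof (intro prod.cong refl)
      fix j assume "j \<in> {1..r}"
      hence "h j \<le> K" using h(2) by (auto simp only: image_subset_iff atMost_iff)
      hence "(1/2::real) ^ h j * (1/2) ^ (K - h j) = 1 / 2 ^ K"
        by (simp add: power_one_over flip: power_add)
      thus "real (K choose h j) * (1/2) ^ h j * (1 - 1/2) ^ (K - h j) = real (K choose h j) / 2 ^ K"
        by (simp add: mult.assoc)
    qed
    also have "\<dots> = (\<Prod>a\<in>H. real (K choose a)) / 2 ^ (K * r)"
      using h(1) by (simp add: H_def prod.reindex prod_dividef power_mult)
    finally show ?thesis .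
  qed
  have "vdm ({..K} - H) * fact K ^ r = superfact (Suc K - r) * F * vdm H * (\<Prod>a\<in>H. real (K choose a))"
    using vdm_complement_binomial[of H K] h(2) superfact_split[OF r] cardH by (simp add: H_def F_def)
  hence compl: "vdm ({..K} - H) =
      superfact (Suc K - r) * F * vdm H * (\<Prod>a\<in>H. real (K choose a)) / fact K ^ r"
    by (simp add: field_simps)
  have two: "2 ^ e1 * 2 ^ e2 / 2 ^ e = (2::real) ^ (r * (r - 1)) / 2 ^ (K * r)"
    using arg_cong[OF e, of "\<lambda>x. (2::real) ^ x"] by (simp add: power_add field_simps)
  have "fact r * krawtchouk r K (1/2) h =
      F / (superfact r * fact K ^ r) * (2 ^ (r * (r - 1)) / 2 ^ (K * r)) *
      (vdm H)\<^sup>2 * (\<Prod>a\<in>H. real (K choose a))"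
    unfolding krawtchouk_def P vdm_image_squared[OF h(1)] Z H_def[symmetric]
    using pos by (simp add: field_simps)
  also have "\<dots> = (2 ^ e1 / superfact r * vdm H) * (2 ^ e2 / superfact (Suc K - r) * vdm ({..K} - H)) / 2 ^ e"
    unfolding two[symmetric] compl using pos by (simp add: field_simps power2_eq_square)
  finally show ?thesis by (simp add: H_def)
qed

text \<open>On the full last diagonal the Vandermonde product is \<open>superfact n\<close>, which
  cancels the denominator.\<close>

lemma card_aztec_matchings_eq:
  "real (card (perfect_matchings (aztec_edges n) (aztec_cells n))) = 2 ^ (n * (n + 1) div 2)"
  using upper_count_black[of n n "{..<n}"] superfact_pos[of n]
  by (simp add: card_aztec_matchings diag_def vdm_lessThan)

text \<open>The balance of exponents for white paths, where \<open>K = n\<close>.\<close>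

lemma triangular_split:
  fixes r n :: nat
  assumes "r \<le> n"
  shows "r * (r - 1) div 2 + (n + 1 - r) * (n - r) div 2 + n * r = n * (n + 1) div 2 + r * (r - 1)"
proof -
  have half: "2 * (Suc k * k div 2) = Suc k * k" for k
    by (intro dvd_mult_div_cancel) simp
  \<comment> \<open>Doubling the equation removes the truncated divisions, which are exact by
    \<open>half\<close>.\<close>
  have lin: "a + b + x = c + y" if "2 * a = p" "2 * b = q" "2 * c = t" "p + q + 2 * x = t + 2 * y"
    for a b c p q t x y :: nat
    using that by linarith
  define m where "m = n - r"
  have n: "n = r + m" using assms by (simp add: m_def)
  show ?thesis
  proof (cases r)
    case (Suc k)
    have "Suc k * k + Suc m * m + 2 * (n * Suc k) = Suc n * n + 2 * (Suc k * k)"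
      unfolding n Suc by (simp add: algebra_simps)
    hence "Suc k * k div 2 + Suc m * m div 2 + n * Suc k = Suc n * n div 2 + Suc k * k"
      by (rule lin[OF half half half])
    moreover have "n + 1 - r = Suc m" "n - r = m" "r - 1 = k" "n * (n + 1) = Suc n * n"
      using n Suc by simp_all
    ultimately show ?thesis by (simp only: Suc)
  qed simp
qed

text \<open>The upper side contributes the Vandermonde product of the turns; the lower side,
  reflected to the white diagonal \<open>2*(n+1-r)\<close>, contributes that of their
  complement.\<close>

lemma white_probability:
  assumes r: "1 \<le> r" "r \<le> n" and h: "inj_on h {1..r}" "h ` {1..r} \<subseteq> {..n}"
  shows "real (card {M \<in> perfect_matchings (aztec_edges n) (aztec_cells n).
      covered_above n M (2*r) = {..n} - h ` {1..r}}) /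
    real (card (perfect_matchings (aztec_edges n) (aztec_cells n))) = fact r * krawtchouk r n (1/2) h"
proof -
  let ?H = "h ` {1..r}"
  have card: "card ?H = r" using h(1) by (simp add: card_image)
  hence card': "card ({..n} - ?H) = n + 1 - r" using h(2) by (subst card_Diff_subset) auto
  have compl: "{..n} - ({..n} - ?H) = ?H" using h(2) by blast
  have "card {M \<in> perfect_matchings (aztec_edges n) (aztec_cells n).
        covered_above n M (2*r) = {..n} - ?H} =
      upper_count n (2*r) ({..n} - ?H) * upper_count n (2*n+2-2*r) (diag n (2*r) - ({..n} - ?H))"
    using r by (intro card_covered_above) (auto simp: diag_def)
  also have "2*n+2-2*r = 2*(n+1-r)" by simp
  also have "diag n (2*r) - ({..n} - ?H) = ?H" using compl by (simp add: diag_def)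
  finally have "real (card {M \<in> perfect_matchings (aztec_edges n) (aztec_cells n).
      covered_above n M (2*r) = {..n} - ?H}) =
      (2 ^ (r * (r - 1) div 2) / superfact r * vdm ?H) *
      (2 ^ ((n + 1 - r) * (n - r) div 2) / superfact (Suc n - r) * vdm ({..n} - ?H))"
    using upper_count_white[of r n "{..n} - ?H", unfolded compl] upper_count_white[of "n + 1 - r" n ?H] r h card card'
    by simp
  thus ?thesis
    using krawtchouk_half[OF h, of "r * (r - 1) div 2" "(n + 1 - r) * (n - r) div 2" "n * (n + 1) div 2"]
      triangular_split[of r n] r by (simp add: card_aztec_matchings_eq)
qed

lemma black_probability:
  assumes r: "1 \<le> r" "r \<le> n" and h: "inj_on h {1..r}" "h ` {1..r} \<subseteq> {..<n}"
  shows "real (card {M \<in> perfect_matchings (aztec_edges n) (aztec_cells n).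
      covered_above n M (2*r+1) = h ` {1..r}}) /
    real (card (perfect_matchings (aztec_edges n) (aztec_cells n))) = fact r * krawtchouk r (n - 1) (1/2) h"
proof -
  let ?H = "h ` {1..r}"
  have card: "card ?H = r" using h(1) by (simp add: card_image)
  hence card': "card ({..<n} - ?H) = n - r" using h(2) by (subst card_Diff_subset) auto
  have lt: "{..<n} = {..n - 1}" using r by auto
  have "card {M \<in> perfect_matchings (aztec_edges n) (aztec_cells n). covered_above n M (2*r+1) = ?H} =
      upper_count n (2*r+1) ?H * upper_count n (2*n+2-(2*r+1)) (diag n (2*r+1) - ?H)"
    using r h by (intro card_covered_above) (auto simp: diag_def)
  also have "2*n+2-(2*r+1) = 2*(n-r)+1" using r by simp
  also have "diag n (2*r+1) - ?H = {..<n} - ?H" by (simp add: diag_def)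
  finally have "real (card {M \<in> perfect_matchings (aztec_edges n) (aztec_cells n).
      covered_above n M (2*r+1) = ?H}) =
      (2 ^ (r * (r + 1) div 2) / superfact r * vdm ?H) *
      (2 ^ ((n - r) * (n - r + 1) div 2) / superfact (n - r) * vdm ({..<n} - ?H))"
    using upper_count_black[of r n ?H] upper_count_black[of "n - r" n "{..<n} - ?H"] r h card card'
    by simp
  \<comment> \<open>Compared with the white balance, the upper exponent grows by \<open>r\<close>
    and \<open>K * r\<close> shrinks by \<open>r\<close>.\<close>
  moreover have e: "r * (r + 1) div 2 + (n - r) * (n - r + 1) div 2 + (n - 1) * r = 
      n * (n + 1) div 2 + r * (r - 1)"
  proof -
    obtain k where k: "r = Suc k" using r by (cases r) auto
    obtain l where l: "n = Suc l" using r by (cases n) auto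
    have "r * (r + 1) div 2 = r * (r - 1) div 2 + r" unfolding k by simp
    moreover have "(n - 1) * r + r = n * r" unfolding l by simp
    moreover have "n + 1 - r = n - r + 1" using r by simp
    hence "(n - r) * (n - r + 1) = (n + 1 - r) * (n - r)" by (simp only: mult.commute)
    ultimately show ?thesis using triangular_split[OF r(2)] by simp
  qed
  moreover have "fact r * krawtchouk r (n - 1) (1/2) h =
      (2 ^ (r * (r + 1) div 2) / superfact r * vdm ?H) *
      (2 ^ ((n - r) * (n - r + 1) div 2) / superfact (n - r) * vdm ({..<n} - ?H)) /
      2 ^ (n * (n + 1) div 2)"
  proof -
    have "Suc (n - 1) = n" using r by simp
    thus ?thesis
      using krawtchouk_half[OF h[unfolded lt] _ e, folded lt] r by simp
  qed
  ultimately show ?thesis by (simp only: card_aztec_matchings_eq)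
qed

section \<open>Tilings and zig-zag paths\<close>

text \<open>With \<open>cell_y\<close>, the lower left corner of the square; the coordinates sum to
  \<open>n - s\<close>.\<close>

definition cell_x :: "nat \<times> nat \<Rightarrow> int" where
  "cell_x = (\<lambda>(s, k). int k - int (s div 2))"

definition cell_y :: "nat \<Rightarrow> nat \<times> nat \<Rightarrow> int" where
  "cell_y n = (\<lambda>(s, k). int n - int s - int k + int (s div 2))"

definition cell_square :: "nat \<Rightarrow> nat \<times> nat \<Rightarrow> (real \<times> real) set" where
  "cell_square n u = lattice_square (cell_x u) (cell_y n u)"

definition tile :: "nat \<Rightarrow> (nat \<times> nat) set \<Rightarrow> (real \<times> real) set" where
  "tile n e = (\<Union>u\<in>e. cell_square n u)"

text \<open>Centres serve as test points: each lies in just one lattice square, so a union of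
  squares determines its cells.\<close>

definition cell_center :: "nat \<Rightarrow> nat \<times> nat \<Rightarrow> real \<times> real" where
  "cell_center n u = (of_int (cell_x u) + 1/2, of_int (cell_y n u) + 1/2)"

lemma cell_eqI: "cell_x u = cell_x v \<Longrightarrow> cell_y n u = cell_y n v \<Longrightarrow> u = v"
proof -
  assume *: "cell_x u = cell_x v" "cell_y n u = cell_y n v"
  have "fst u = fst v"
    using * by (cases u; cases v) (auto simp: cell_x_def cell_y_def)
  with *(1) show "u = v"
    by (cases u; cases v) (auto simp: cell_x_def)
qed

lemma half_between_ints: "of_int a \<le> of_int m + (1/2::real) \<Longrightarrow> of_int m + (1/2::real) \<le> of_int a + 1 \<Longrightarrow> m = a"
  by linarith

lemma center_in_lattice_square_iff:
  "(of_int m + 1/2, of_int l + 1/2) \<in> lattice_square m' l' \<longleftrightarrow> m = m' \<and> l = l'"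
  using half_between_ints[of m' m] half_between_ints[of l' l] by (auto simp: lattice_square_def)

lemma center_in_tile_iff: "cell_center n u \<in> tile n e \<longleftrightarrow> u \<in> e"
  using cell_eqI[of u _ n]
  by (auto simp: tile_def cell_square_def cell_center_def center_in_lattice_square_iff)

lemma tile_eqD: "tile n e = tile n e' \<Longrightarrow> e = e'"
  using center_in_tile_iff[of n] by blast

text \<open>By convexity the four corners decide; each inequality comes from the corner farthest out
  in its quadrant, with \<open>(m, l)\<close> the lower left one.\<close>

lemma lattice_square_subset_iff:
  "lattice_square m l \<subseteq> {(x, y). \<bar>x\<bar> + \<bar>y\<bar> \<le> real n + 1} \<longleftrightarrow>
    - int n - 1 \<le> m + l \<and> m + l \<le> int n - 1 \<and> m - l \<le> int n \<and> l - m \<le> int n" (is "?L \<longleftrightarrow> ?R")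
proof
  assume L: ?L
  have "\<bar>of_int a\<bar> + \<bar>of_int b\<bar> \<le> real n + 1" if "a = m \<or> a = m + 1" "b = l \<or> b = l + 1" for a b
  proof -
    have "(of_int a, of_int b) \<in> lattice_square m l"
      using that by (auto simp: lattice_square_def)
    thus ?thesis using L by blast
  qed
  hence "\<bar>a\<bar> + \<bar>b\<bar> \<le> int n + 1" if "a = m \<or> a = m + 1" "b = l \<or> b = l + 1" for a b
    using that by (metis (mono_tags, opaque_lifting) of_int_abs of_int_add of_int_le_iff of_int_of_nat_eq of_int_1)
  from this[of m l] this[of "m+1" l] this[of m "l+1"] this[of "m+1" "l+1"]
  show ?R by auto
next
  assume R: ?R
  hence "real_of_int (- int n - 1) \<le> of_int (m + l)" "real_of_int (m + l) \<le> of_int (int n - 1)"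
    "real_of_int (m - l) \<le> of_int (int n)" "real_of_int (l - m) \<le> of_int (int n)"
    unfolding of_int_le_iff by auto
  thus ?L
    by (auto simp: lattice_square_def abs_if)
qed

text \<open>The bounds on \<open>m + l\<close> give the range of diagonals. Those on
  \<open>m - l\<close> give the range of \<open>k\<close>: the difference is
  \<open>2 * k - n\<close> on white and \<open>2 * k - n + 1\<close> on black diagonals, which
  leaves \<open>n + 1\<close> and \<open>n\<close> values.\<close>

lemma aztec_cell_iff:
  "(\<exists>u\<in>aztec_cells n. m = cell_x u \<and> l = cell_y n u) \<longleftrightarrow>
    - int n - 1 \<le> m + l \<and> m + l \<le> int n - 1 \<and> m - l \<le> int n \<and> l - m \<le> int n" (is "?L \<longleftrightarrow> ?R")
proof
  assume ?L
  then obtain s k where "(s, k) \<in> aztec_cells n" "m = cell_x (s, k)" "l = cell_y n (s, k)" by auto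
  thus ?R
    by (cases "even s")
      (auto simp: aztec_cells_def diag_def cell_x_def cell_y_def elim!: evenE oddE)
next
  assume R: ?R
  define s where "s = nat (int n - m - l)"
  define k where "k = nat (m + int (s div 2))"
  have s: "int s = int n - m - l" using R by (simp add: s_def)
  have s2: "2 * int (s div 2) = int s - (if even s then 0 else 1)"
    by (cases "even s") (auto elim!: evenE oddE)
  hence k: "int k = m + int (s div 2)" using R s by (auto simp: k_def split: if_splits)
  have "(s, k) \<in> aztec_cells n"
    using s s2 k R by (auto simp: aztec_cells_def diag_def split: if_splits)
  moreover have "m = cell_x (s, k)" "l = cell_y n (s, k)"
    using s k by (auto simp: cell_x_def cell_y_def)
  ultimately show ?L by blast
qed

lemma aztec_eq_tile: "aztec n = tile n (aztec_cells n)"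
  unfolding aztec_def tile_def cell_square_def lattice_square_subset_iff aztec_cell_iff[symmetric]
  by blast

lemma aztec_edges_iff:
  assumes "u \<in> aztec_cells n" "v \<in> aztec_cells n"
    and "cell_x v = cell_x u + 1 \<and> cell_y n v = cell_y n u \<or>
      cell_x v = cell_x u \<and> cell_y n v = cell_y n u + 1"
  shows "{u, v} \<in> aztec_edges n"
proof -
  obtain s a where v: "v = (s, a)" by (cases v)
  obtain s' b where u: "u = (s', b)" by (cases u)
  \<comment> \<open>A step right or up raises the coordinate sum by one and so lowers the diagonal
    index by one.\<close>
  have s': "s' = Suc s"
    using assms(3) by (auto simp: u v cell_x_def cell_y_def)
  have "adj s a b"
    using assms(3) unfolding u v s'
    by (cases "even s") (auto simp: cell_x_def cell_y_def adj_def elim!: evenE oddE)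
  hence "{v, u} \<in> edges n s"
    using assms(1,2) unfolding edges_def u v s' by (auto simp: aztec_cells_def)
  moreover have "1 \<le> s" "s < 2*n+1"
    using assms(1,2) by (auto simp: u v s' aztec_cells_def)
  ultimately show ?thesis
    by (auto simp: aztec_edges_def upper_edges_def insert_commute)
qed

lemma aztec_edgesE:
  assumes "e \<in> aztec_edges n"
  obtains s a b where "e = {(s, a), (Suc s, b)}" "e \<in> edges n s" "1 \<le> s" "s \<le> 2*n" "e \<subseteq> aztec_cells n"
    and "cell_x (s, a) = cell_x (Suc s, b) + 1 \<and> cell_y n (s, a) = cell_y n (Suc s, b) \<or>
      cell_x (s, a) = cell_x (Suc s, b) \<and> cell_y n (s, a) = cell_y n (Suc s, b) + 1"
proof -
  obtain s where s: "e \<in> edges n s" "1 \<le> s" "s \<le> 2*n"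
    using assms by (auto simp: aztec_edges_def upper_edges_def)
  then obtain a b where ab: "e = {(s, a), (Suc s, b)}" "a \<in> diag n s" "b \<in> diag n (Suc s)" "adj s a b"
    by (auto elim!: edgesE)
  have "cell_x (s, a) = cell_x (Suc s, b) + 1 \<and> cell_y n (s, a) = cell_y n (Suc s, b) \<or>
      cell_x (s, a) = cell_x (Suc s, b) \<and> cell_y n (s, a) = cell_y n (Suc s, b) + 1"
    using ab(4) by (cases "even s") (auto simp: adj_def cell_x_def cell_y_def elim!: evenE oddE)
  moreover have "e \<subseteq> aztec_cells n" using s ab by (auto simp: aztec_cells_def)
  ultimately show ?thesis using that s ab(1) by blast
qed

lemma lattice_square_Un:
  "lattice_square a b \<union> lattice_square (a + 1) b = {of_int a .. of_int a + 2} \<times> {of_int b .. of_int b + 1}"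
  "lattice_square a b \<union> lattice_square a (b + 1) = {of_int a .. of_int a + 1} \<times> {of_int b .. of_int b + 2}"
  by (auto simp: lattice_square_def)

text \<open>In either orientation the cell on the later diagonal is the lower left one and anchors
  the domino.\<close>

lemma tile_edge_cases:
  assumes "e \<in> aztec_edges n"
  obtains s a b where "e = {(s, a), (Suc s, b)}" "e \<in> edges n s" "1 \<le> s" "s \<le> 2*n"
    "cell_x (s, a) = cell_x (Suc s, b) + 1" "cell_y n (s, a) = cell_y n (Suc s, b)"
    "tile n e = {of_int (cell_x (Suc s, b)) .. of_int (cell_x (Suc s, b)) + 2} \<times>
      {of_int (cell_y n (Suc s, b)) .. of_int (cell_y n (Suc s, b)) + 1}"
  | s a b where "e = {(s, a), (Suc s, b)}" "e \<in> edges n s" "1 \<le> s" "s \<le> 2*n"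
    "cell_x (s, a) = cell_x (Suc s, b)" "cell_y n (s, a) = cell_y n (Suc s, b) + 1"
    "tile n e = {of_int (cell_x (Suc s, b)) .. of_int (cell_x (Suc s, b)) + 1} \<times>
      {of_int (cell_y n (Suc s, b)) .. of_int (cell_y n (Suc s, b)) + 2}"
proof -
  obtain s a b where e: "e = {(s, a), (Suc s, b)}" "e \<in> edges n s" "1 \<le> s" "s \<le> 2*n" 
    and *: "cell_x (s, a) = cell_x (Suc s, b) + 1 \<and> cell_y n (s, a) = cell_y n (Suc s, b) \<or>
      cell_x (s, a) = cell_x (Suc s, b) \<and> cell_y n (s, a) = cell_y n (Suc s, b) + 1"
    using aztec_edgesE[OF assms] by metis
  have tile: "tile n e = cell_square n (Suc s, b) \<union> cell_square n (s, a)"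
    by (auto simp: tile_def e)
  from * show ?thesis
  proof (elim disjE conjE)
    assume **: "cell_x (s, a) = cell_x (Suc s, b) + 1" "cell_y n (s, a) = cell_y n (Suc s, b)"
    show ?thesis
      by (rule that(1)[OF e **]) (simp only: tile cell_square_def ** lattice_square_Un)
  next
    assume **: "cell_x (s, a) = cell_x (Suc s, b)" "cell_y n (s, a) = cell_y n (Suc s, b) + 1"
    show ?thesis
      by (rule that(2)[OF e **]) (simp only: tile cell_square_def ** lattice_square_Un)
  qed
qed

lemma domino_tile: "e \<in> aztec_edges n \<Longrightarrow> domino (tile n e)"
  by (erule tile_edge_cases) (unfold domino_def, blast+)

lemma domino_in_aztec:
  assumes "domino D" "D \<subseteq> aztec n"
  obtains e where "e \<in> aztec_edges n" "D = tile n e"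
proof -
  have cell: "\<exists>u\<in>aztec_cells n. m = cell_x u \<and> l = cell_y n u" if "lattice_square m l \<subseteq> D" for m l
  proof -
    have "(of_int m + 1/2, of_int l + 1/2) \<in> lattice_square m l"
      by (simp add: center_in_lattice_square_iff)
    hence "(of_int m + 1/2, of_int l + 1/2) \<in> tile n (aztec_cells n)"
      using that assms(2) by (auto simp: aztec_eq_tile)
    thus ?thesis
      by (auto simp: tile_def cell_square_def center_in_lattice_square_iff)
  qed
  obtain a b where "D = lattice_square a b \<union> lattice_square (a + 1) b \<or>
      D = lattice_square a b \<union> lattice_square a (b + 1)"
    using assms(1) unfolding domino_def lattice_square_Un by blast
  then obtain a' b' where D: "D = lattice_square a b \<union> lattice_square a' b'"
    and *: "a' = a + 1 \<and> b' = b \<or> a' = a \<and> b' = b + 1"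
    by blast
  obtain u v where "u \<in> aztec_cells n" "a = cell_x u" "b = cell_y n u"
    "v \<in> aztec_cells n" "a' = cell_x v" "b' = cell_y n v"
    using cell[of a b] cell[of a' b'] D by blast
  thus ?thesis
    using aztec_edges_iff[of u n v] * D that[of "{u, v}"] by (auto simp: tile_def cell_square_def)
qed

lemma interior_tile_box:
  assumes "e \<in> aztec_edges n"
  obtains a b p q :: int where "interior (tile n e) = {of_int a <..< of_int p} \<times> {of_int b <..< of_int q}"
proof -
  obtain a b where "tile n e = {of_int a .. of_int a + 2} \<times> {of_int b .. of_int b + 1} \<or>
     tile n e = {of_int a .. of_int a + 1} \<times> {of_int b .. of_int b + 2}"
    using domino_tile[OF assms] unfolding domino_def by blast
  thus ?thesis
    using that[of a "a+2" b "b+1"] that[of a "a+1" b "b+2"]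
    by (auto simp: interior_Times)
qed

text \<open>Open boxes with integer corners that meet share the centre of a lattice square, hence a
  cell.\<close>

lemma tile_interiors_disjoint_iff:
  assumes "e \<in> aztec_edges n" "e' \<in> aztec_edges n"
  shows "interior (tile n e) \<inter> interior (tile n e') = {} \<longleftrightarrow> disjnt e e'"
proof
  assume *: "interior (tile n e) \<inter> interior (tile n e') = {}"
  have "cell_center n u \<in> interior (tile n e)" if "u \<in> e" for u e
  proof -
    have "cell_center n u \<in> interior (cell_square n u)"
      by (simp add: cell_center_def cell_square_def lattice_square_def interior_Times)
    moreover have "interior (cell_square n u) \<subseteq> interior (tile n e)"
      using that by (intro interior_mono) (auto simp: tile_def)
    ultimately show ?thesis by blast
  qed
  with * show "disjnt e e'" unfolding disjnt_def by blast
next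
  assume dis: "disjnt e e'"
  obtain a b p q :: int where box: "interior (tile n e) = {of_int a <..< of_int p} \<times> {of_int b <..< of_int q}"
    using interior_tile_box[OF assms(1)] .
  obtain a' b' p' q' :: int where box': "interior (tile n e') = {of_int a' <..< of_int p'} \<times> {of_int b' <..< of_int q'}"
    using interior_tile_box[OF assms(2)] .
  show "interior (tile n e) \<inter> interior (tile n e') = {}"
  proof (rule ccontr)
    assume "interior (tile n e) \<inter> interior (tile n e') \<noteq> {}"
    then obtain x y where "(x, y) \<in> interior (tile n e)" "(x, y) \<in> interior (tile n e')" by auto
    hence "max a a' < min p p'" "max b b' < min q q'"
      unfolding box box' by (auto simp: max_def min_def)
    define m l where "m = max a a'" and "l = max b b'"
    have "of_int m + (1/2::real) \<in> {of_int a <..< of_int p} \<inter> {of_int a' <..< of_int p'}"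
      "of_int l + (1/2::real) \<in> {of_int b <..< of_int q} \<inter> {of_int b' <..< of_int q'}"
      using \<open>max a a' < min p p'\<close> \<open>max b b' < min q q'\<close> unfolding m_def l_def
      by (auto simp: max_def min_def split: if_splits)
    hence "(of_int m + 1/2, of_int l + 1/2) \<in> tile n e" "(of_int m + 1/2, of_int l + 1/2) \<in> tile n e'"
      using box box' interior_subset by blast+
    then obtain u v where "u \<in> e" "v \<in> e'" "m = cell_x u" "l = cell_y n u" "m = cell_x v" "l = cell_y n v"
      by (auto simp: tile_def cell_square_def center_in_lattice_square_iff)
    hence "u = v" by (intro cell_eqI[of _ _ n]) auto
    thus False using \<open>u \<in> e\<close> \<open>v \<in> e'\<close> dis by (auto simp: disjnt_def)
  qed
qed

lemma bij_betw_matchings_tilings: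
  "bij_betw ((`) (tile n)) (perfect_matchings (aztec_edges n) (aztec_cells n)) (aztec_tilings n)"
  unfolding bij_betw_def
proof
  show "inj_on ((`) (tile n)) (perfect_matchings (aztec_edges n) (aztec_cells n))"
  proof (rule inj_onI)
    fix M M' assume "tile n ` M = tile n ` M'"
    moreover have "inj (tile n)" by (rule injI) (rule tile_eqD)
    ultimately show "M = M'" by (simp add: inj_image_eq_iff)
  qed
  show "(`) (tile n) ` perfect_matchings (aztec_edges n) (aztec_cells n) = aztec_tilings n"
  proof (intro equalityI subsetI)
    fix T assume "T \<in> (`) (tile n) ` perfect_matchings (aztec_edges n) (aztec_cells n)"
    then obtain M where M: "M \<subseteq> aztec_edges n" "pairwise disjnt M" "\<Union>M = aztec_cells n" "T = tile n ` M"
      by (auto simp: perfect_matchings_def)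
    have "\<Union>T = aztec n"
      unfolding M(4) aztec_eq_tile M(3)[symmetric] by (auto simp: tile_def)
    moreover have "pairwise (\<lambda>D D'. interior D \<inter> interior D' = {}) T"
    proof (rule pairwiseI)
      fix D D' assume D: "D \<in> T" "D' \<in> T" "D \<noteq> D'"
      then obtain e e' where e: "e \<in> M" "e' \<in> M" "D = tile n e" "D' = tile n e'"
        using M(4) by blast
      hence "disjnt e e'" using D(3) M(2) by (auto simp: pairwise_def)
      thus "interior D \<inter> interior D' = {}"
        using tile_interiors_disjoint_iff M(1) e by blast
    qed
    ultimately show "T \<in> aztec_tilings n"
      using M domino_tile by (auto simp: aztec_tilings_def domino_tiling_def)
  next
    fix T assume "T \<in> aztec_tilings n"
    hence T: "\<And>D. D \<in> T \<Longrightarrow> domino D" "pairwise (\<lambda>D D'. interior D \<inter> interior D' = {}) T" "\<Union>T = aztec n"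
      by (auto simp: aztec_tilings_def domino_tiling_def)
    define M where "M = {e \<in> aztec_edges n. tile n e \<in> T}"
    have TM: "T = tile n ` M"
    proof (intro equalityI subsetI)
      fix D assume D: "D \<in> T"
      then obtain e where "e \<in> aztec_edges n" "D = tile n e"
        using domino_in_aztec[of D n] T by blast
      thus "D \<in> tile n ` M" using D by (auto simp: M_def)
    qed (auto simp: M_def)
    have "pairwise disjnt M"
    proof (rule pairwiseI)
      fix e e' assume e: "e \<in> M" "e' \<in> M" "e \<noteq> e'"
      hence "tile n e \<noteq> tile n e'" using tile_eqD by blast
      hence "interior (tile n e) \<inter> interior (tile n e') = {}"
        using T(2) e by (auto simp: pairwise_def M_def)
      thus "disjnt e e'" using tile_interiors_disjoint_iff e by (auto simp: M_def)
    qed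
    moreover have "\<Union>M = aztec_cells n"
    proof (intro equalityI subsetI)
      fix u assume "u \<in> \<Union>M"
      thus "u \<in> aztec_cells n" unfolding M_def by (blast elim: aztec_edgesE)
    next
      fix u assume "u \<in> aztec_cells n"
      hence "cell_center n u \<in> aztec n" by (simp add: aztec_eq_tile center_in_tile_iff)
      then obtain D where "D \<in> T" "cell_center n u \<in> D" using T(3) by blast
      then obtain e where "e \<in> M" "cell_center n u \<in> tile n e" using TM by blast
      thus "u \<in> \<Union>M" by (auto simp: center_in_tile_iff)
    qed
    ultimately have "M \<in> perfect_matchings (aztec_edges n) (aztec_cells n)"
      by (auto simp: perfect_matchings_def M_def)
    thus "T \<in> (`) (tile n) ` perfect_matchings (aztec_edges n) (aztec_cells n)"
      using TM by blast
  qed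
qed

section \<open>Zig-zag paths as point sets\<close>

lemma length_concat_pairs [simp]: "length (concat (map (\<lambda>k. [f k, g k]) [0..<m])) = 2 * m"
  by (induction m) auto

lemma nth_concat_pairs:
  assumes "k < m"
  shows "concat (map (\<lambda>k. [f k, g k]) [0..<m]) ! (2 * k) = f k"
    and "concat (map (\<lambda>k. [f k, g k]) [0..<m]) ! Suc (2 * k) = g k"
  using assms by (induction m) (auto simp: nth_append less_Suc_eq)

lemma length_zigzag_path: "length (zigzag_path C m E) = Suc (2 * m)"
  by (simp add: zigzag_path_def)

lemma nth_zigzag_path:
  shows "k \<le> m \<Longrightarrow> zigzag_path C m E ! (2 * k) = C k"
    and "k < m \<Longrightarrow> zigzag_path C m E ! Suc (2 * k) = C k + (if k \<in> E then (1, 0) else (0, -1))"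
  unfolding zigzag_path_def by (auto simp: nth_append nth_concat_pairs le_less)

lemma zigzag_path_inj:
  assumes "zigzag_path C m E = zigzag_path C m E'" "E \<subseteq> {..<m}" "E' \<subseteq> {..<m}"
  shows "E = E'"
proof -
  have "k \<in> E \<longleftrightarrow> k \<in> E'" if "k < m" for k
    using nth_zigzag_path(2)[OF that, of C E] nth_zigzag_path(2)[OF that, of C E'] assms(1)
    by (auto split: if_splits)
  thus ?thesis using assms(2,3) by blast
qed

lemma polyline_zigzag_path:
  "polyline (zigzag_path C m E) = (\<Union>k<m. let P = C k + (if k \<in> E then (1, 0) else (0, -1)) in
    closed_segment (C k) P \<union> closed_segment P (C (Suc k)))"
proof -
  let ?z = "zigzag_path C m E"
  have "{..<2*m} = (\<lambda>k. 2 * k) ` {..<m} \<union> (\<lambda>k. Suc (2 * k)) ` {..<m}"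
  proof (intro equalityI subsetI)
    fix i assume "i \<in> {..<2*m}"
    thus "i \<in> (\<lambda>k. 2 * k) ` {..<m} \<union> (\<lambda>k. Suc (2 * k)) ` {..<m}"
      by (cases "even i") (auto elim!: evenE oddE)
  qed auto
  hence "polyline ?z = (\<Union>k<m. closed_segment (?z ! (2 * k)) (?z ! Suc (2 * k)) \<union>
      closed_segment (?z ! Suc (2 * k)) (?z ! (2 * Suc k)))"
    by (auto simp: polyline_def length_zigzag_path)
  also have "\<dots> = (\<Union>k<m. let P = C k + (if k \<in> E then (1, 0) else (0, -1)) in
    closed_segment (C k) P \<union> closed_segment P (C (Suc k)))"
    by (intro SUP_cong refl) (simp only: nth_zigzag_path Let_def lessThan_iff Suc_leI less_imp_le)
  finally show ?thesis .
qed

lemma closed_segment_horizontal: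
  "closed_segment (x, y) (x', y) = closed_segment x x' \<times> {y :: real}"
proof -
  have "(1 - u) * y + u * y = y" for u by (simp add: algebra_simps)
  thus ?thesis by (auto simp: closed_segment_def)
qed

lemma closed_segment_vertical:
  "closed_segment (x, y) (x, y') = {x :: real} \<times> closed_segment y y'"
proof -
  have "(1 - u) * x + u * x = x" for u by (simp add: algebra_simps)
  thus ?thesis by (auto simp: closed_segment_def)
qed

section \<open>Which sides of a square a domino crosses\<close>

text \<open>The stretch of a path around the square at an east/south turn; \<open>lower_left\<close>
  is the one at a south/east turn.\<close>

definition upper_right :: "nat \<Rightarrow> nat \<times> nat \<Rightarrow> (real \<times> real) set" where
  "upper_right n u = (let x = of_int (cell_x u); y = of_int (cell_y n u) in
    {x .. x + 1} \<times> {y + 1} \<union> {x + 1} \<times> {y .. y + 1})"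

definition lower_left :: "nat \<Rightarrow> nat \<times> nat \<Rightarrow> (real \<times> real) set" where
  "lower_left n u = (let x = of_int (cell_x u); y = of_int (cell_y n u) in
    {x} \<times> {y .. y + 1} \<union> {x .. x + 1} \<times> {y})"

text \<open>The only lattice edge entering the interior of a domino is the one shared by its two
  squares. It is the top or right side of the lower left square and the bottom or left side of the
  other.\<close>

lemma edges_meet_box_iff:
  fixes m l a b :: int
  defines "x \<equiv> real_of_int m" and "y \<equiv> real_of_int l" and "p \<equiv> real_of_int a" and "q \<equiv> real_of_int b"
  shows "({x .. x + 1} \<times> {y + 1} \<union> {x + 1} \<times> {y .. y + 1}) \<inter> ({p <..< p + 2} \<times> {q <..< q + 1}) \<noteq> {}
      \<longleftrightarrow> m = a \<and> l = b" (is "?A \<inter> ?H \<noteq> {} \<longleftrightarrow> _")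
    and "({x .. x + 1} \<times> {y + 1} \<union> {x + 1} \<times> {y .. y + 1}) \<inter> ({p <..< p + 1} \<times> {q <..< q + 2}) \<noteq> {}
      \<longleftrightarrow> m = a \<and> l = b" (is "_ \<inter> ?V \<noteq> {} \<longleftrightarrow> _")
    and "({x} \<times> {y .. y + 1} \<union> {x .. x + 1} \<times> {y}) \<inter> ({p <..< p + 2} \<times> {q <..< q + 1}) \<noteq> {}
      \<longleftrightarrow> m = a + 1 \<and> l = b" (is "?B \<inter> _ \<noteq> {} \<longleftrightarrow> _")
    and "({x} \<times> {y .. y + 1} \<union> {x .. x + 1} \<times> {y}) \<inter> ({p <..< p + 1} \<times> {q <..< q + 2}) \<noteq> {}
      \<longleftrightarrow> m = a \<and> l = b + 1"
proof -
  have "m = a \<and> l = b" if "z \<in> ?A" "z \<in> ?H" for z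
    using that unfolding x_def y_def p_def q_def by (cases z) (auto; linarith)
  \<comment> \<open>The witnesses here and below are midpoints of the shared edge.\<close>
  moreover have "(x + 1, y + 1/2) \<in> ?A \<inter> ?H" if "m = a \<and> l = b"
    using that unfolding x_def y_def p_def q_def by auto
  ultimately show "?A \<inter> ?H \<noteq> {} \<longleftrightarrow> m = a \<and> l = b" by blast
  have "m = a \<and> l = b" if "z \<in> ?A" "z \<in> ?V" for z
    using that unfolding x_def y_def p_def q_def by (cases z) (auto; linarith)
  moreover have "(x + 1/2, y + 1) \<in> ?A \<inter> ?V" if "m = a \<and> l = b"
    using that unfolding x_def y_def p_def q_def by auto
  ultimately show "?A \<inter> ?V \<noteq> {} \<longleftrightarrow> m = a \<and> l = b" by blast
  have "m = a + 1 \<and> l = b" if "z \<in> ?B" "z \<in> ?H" for z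
    using that unfolding x_def y_def p_def q_def by (cases z) (auto; linarith)
  moreover have "(x, y + 1/2) \<in> ?B \<inter> ?H" if "m = a + 1 \<and> l = b"
    using that unfolding x_def y_def p_def q_def by auto
  ultimately show "?B \<inter> ?H \<noteq> {} \<longleftrightarrow> m = a + 1 \<and> l = b" by blast
  have "m = a \<and> l = b + 1" if "z \<in> ?B" "z \<in> ?V" for z
    using that unfolding x_def y_def p_def q_def by (cases z) (auto; linarith)
  moreover have "(x + 1/2, y) \<in> ?B \<inter> ?V" if "m = a \<and> l = b + 1"
    using that unfolding x_def y_def p_def q_def by auto
  ultimately show "?B \<inter> ?V \<noteq> {} \<longleftrightarrow> m = a \<and> l = b + 1" by blast
qed

lemma cell_eq_iff: "cell_x u = cell_x v \<and> cell_y n u = cell_y n v \<longleftrightarrow> u = v"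
  using cell_eqI by blast

lemma sides_meet_tile_iff:
  assumes "e \<in> aztec_edges n"
  shows "upper_right n u \<inter> interior (tile n e) \<noteq> {} \<longleftrightarrow> u \<in> e \<and> e \<in> upper_edges n (fst u)"
    and "lower_left n u \<inter> interior (tile n e) \<noteq> {} \<longleftrightarrow> u \<in> e \<and> e \<notin> upper_edges n (fst u)"
proof -
  have up: "u \<in> e \<and> e \<in> upper_edges n (fst u) \<longleftrightarrow> u = (Suc s, b)"
    "u \<in> e \<and> e \<notin> upper_edges n (fst u) \<longleftrightarrow> u = (s, a)"
    if "e = {(s, a), (Suc s, b)}" "e \<in> edges n s" "1 \<le> s" for s a b
  proof -
    have "e \<in> upper_edges n (Suc s)" using that(2,3) by (auto simp: upper_edges_def)
    moreover have "e \<notin> upper_edges n s"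
      using upper_edges_bound[of e n s "Suc s" b] that(1) by auto
    ultimately show "u \<in> e \<and> e \<in> upper_edges n (fst u) \<longleftrightarrow> u = (Suc s, b)"
      "u \<in> e \<and> e \<notin> upper_edges n (fst u) \<longleftrightarrow> u = (s, a)" using that(1) by auto
  qed
  from assms have "(upper_right n u \<inter> interior (tile n e) \<noteq> {} \<longleftrightarrow> u \<in> e \<and> e \<in> upper_edges n (fst u)) \<and>
      (lower_left n u \<inter> interior (tile n e) \<noteq> {} \<longleftrightarrow> u \<in> e \<and> e \<notin> upper_edges n (fst u))"
  proof (cases rule: tile_edge_cases)
    case (1 s a b)
    show ?thesis
      unfolding up[OF 1(1-3)] upper_right_def lower_left_def Let_def 1(7) interior_Times
        interior_atLeastAtMost_real edges_meet_box_iff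
      using 1(5,6) cell_eq_iff[of u "(Suc s, b)" n] cell_eq_iff[of u "(s, a)" n] by auto
  next
    case (2 s a b)
    show ?thesis
      unfolding up[OF 2(1-3)] upper_right_def lower_left_def Let_def 2(7) interior_Times
        interior_atLeastAtMost_real edges_meet_box_iff
      using 2(5,6) cell_eq_iff[of u "(Suc s, b)" n] cell_eq_iff[of u "(s, a)" n] by auto
  qed
  thus "upper_right n u \<inter> interior (tile n e) \<noteq> {} \<longleftrightarrow> u \<in> e \<and> e \<in> upper_edges n (fst u)"
    and "lower_left n u \<inter> interior (tile n e) \<noteq> {} \<longleftrightarrow> u \<in> e \<and> e \<notin> upper_edges n (fst u)"
    by blast+
qed

definition diag_corner :: "nat \<Rightarrow> nat \<Rightarrow> nat \<Rightarrow> real \<times> real" where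
  "diag_corner n s k = (of_int (cell_x (s, k)), of_int (cell_y n (s, k)) + 1)"

lemma polyline_diag:
  "polyline (zigzag_path (diag_corner n s) m E) =
    (\<Union>k<m. if k \<in> E then upper_right n (s, k) else lower_left n (s, k))"
  unfolding polyline_zigzag_path
proof (intro SUP_cong refl)
  fix k
  let ?x = "real_of_int (cell_x (s, k))" and ?y = "real_of_int (cell_y n (s, k))"
  have corners: "diag_corner n s k = (?x, ?y + 1)" "diag_corner n s (Suc k) = (?x + 1, ?y)"
    by (simp_all add: diag_corner_def cell_x_def cell_y_def)
  show "(let P = diag_corner n s k + (if k \<in> E then (1, 0) else (0, -1)) in
      closed_segment (diag_corner n s k) P \<union> closed_segment P (diag_corner n s (Suc k))) =
    (if k \<in> E then upper_right n (s, k) else lower_left n (s, k))"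
    by (simp add: corners closed_segment_horizontal closed_segment_vertical
        closed_segment_eq_real_ivl upper_right_def lower_left_def Let_def)
qed

text \<open>Exactly one domino covers each square of the diagonal, and it blocks exactly one of the
  two ways around it: the upper right way if it extends upwards, the lower left way otherwise. This
  yields existence and uniqueness of the path.\<close>

lemma zigzag_avoids_iff:
  assumes M: "M \<in> perfect_matchings (aztec_edges n) (aztec_cells n)"
    and s: "1 \<le> s" "s \<le> 2*n+1" and m: "diag n s = {..<m}" and E: "E \<subseteq> {..<m}"
  shows "(\<forall>D\<in>tile n ` M. polyline (zigzag_path (diag_corner n s) m E) \<inter> interior D = {}) \<longleftrightarrow>
    E = {..<m} - covered_above n M s"
proof -
  have ME: "M \<subseteq> aztec_edges n" and MV: "\<Union>M = aztec_cells n"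
    using M by (auto simp: perfect_matchings_def)
  have side: "(if k \<in> E then upper_right n (s, k) else lower_left n (s, k)) \<inter> interior (tile n e) = {} \<longleftrightarrow>
      ((s, k) \<in> e \<longrightarrow> (k \<in> E \<longleftrightarrow> e \<notin> upper_edges n s))" if "e \<in> M" for e k
    using sides_meet_tile_iff[of e n "(s, k)"] that ME by auto
  have "(\<forall>D\<in>tile n ` M. polyline (zigzag_path (diag_corner n s) m E) \<inter> interior D = {}) \<longleftrightarrow>
      (\<forall>e\<in>M. \<forall>k<m. (if k \<in> E then upper_right n (s, k) else lower_left n (s, k)) \<inter> interior (tile n e) = {})"
    unfolding polyline_diag by blast
  also have "\<dots> \<longleftrightarrow> (\<forall>k<m. \<forall>e\<in>M. (s, k) \<in> e \<longrightarrow> (k \<in> E \<longleftrightarrow> e \<notin> upper_edges n s))"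
    using side by blast
  also have "\<dots> \<longleftrightarrow> (\<forall>k<m. k \<in> E \<longleftrightarrow> k \<notin> covered_above n M s)"
  proof (intro all_cong1 imp_cong refl)
    fix k assume "k < m"
    hence "(s, k) \<in> \<Union>M" using MV m s by (auto simp: aztec_cells_def)
    then obtain e where e: "e \<in> M" "(s, k) \<in> e" by blast
    have "e' = e" if "e' \<in> M" "(s, k) \<in> e'" for e'
      using perfect_matchings_unique[OF M] e that by blast
    with e show "(\<forall>e\<in>M. (s, k) \<in> e \<longrightarrow> (k \<in> E \<longleftrightarrow> e \<notin> upper_edges n s)) \<longleftrightarrow>
        (k \<in> E \<longleftrightarrow> k \<notin> covered_above n M s)"
      unfolding covered_above_def by blast
  qed
  also have "\<dots> \<longleftrightarrow> E = {..<m} - covered_above n M s"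
    using E by auto
  finally show ?thesis .
qed

lemma tiling_zigzag_eq:
  assumes M: "M \<in> perfect_matchings (aztec_edges n) (aztec_cells n)"
    and s: "1 \<le> s" "s \<le> 2*n+1" and m: "diag n s = {..<m}"
  shows "tiling_zigzag (diag_corner n s) m (tile n ` M) =
    zigzag_path (diag_corner n s) m ({..<m} - covered_above n M s)"
  unfolding tiling_zigzag_def
proof (rule the_equality)
  have "{..<m} - covered_above n M s \<subseteq> {..<m}" by auto
  thus "zigzag_path (diag_corner n s) m ({..<m} - covered_above n M s) \<in> zigzag_paths (diag_corner n s) m \<and>
      (\<forall>D\<in>tile n ` M. polyline (zigzag_path (diag_corner n s) m ({..<m} - covered_above n M s)) \<inter> interior D = {})"
    using zigzag_avoids_iff[OF assms] unfolding zigzag_paths_def by blast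
next
  fix \<gamma> assume "\<gamma> \<in> zigzag_paths (diag_corner n s) m \<and> (\<forall>D\<in>tile n ` M. polyline \<gamma> \<inter> interior D = {})"
  then obtain E where "\<gamma> = zigzag_path (diag_corner n s) m E" "E \<subseteq> {..<m}"
      "\<forall>D\<in>tile n ` M. polyline (zigzag_path (diag_corner n s) m E) \<inter> interior D = {}"
    unfolding zigzag_paths_def by blast
  thus "\<gamma> = zigzag_path (diag_corner n s) m ({..<m} - covered_above n M s)"
    using zigzag_avoids_iff[OF assms] by blast
qed

lemma tiling_zigzag_eq_path_iff:
  assumes M: "M \<in> perfect_matchings (aztec_edges n) (aztec_cells n)"
    and s: "1 \<le> s" "s \<le> 2*n+1" and m: "diag n s = {..<m}" and E: "E \<subseteq> {..<m}"
  shows "tiling_zigzag (diag_corner n s) m (tile n ` M) = zigzag_path (diag_corner n s) m E \<longleftrightarrow>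
    covered_above n M s = {..<m} - E"
proof -
  have "covered_above n M s \<subseteq> {..<m}"
    using upper_edges_bound m by (fastforce simp: covered_above_def)
  moreover have "tiling_zigzag (diag_corner n s) m (tile n ` M) = zigzag_path (diag_corner n s) m E \<longleftrightarrow>
      {..<m} - covered_above n M s = E"
    unfolding tiling_zigzag_eq[OF M s m] using zigzag_path_inj[OF _ _ E] by blast
  ultimately show ?thesis using E by blast
qed

lemma white_corner_eq: "white_corner n r = diag_corner n (2*r)"
  by (auto simp: fun_eq_iff white_corner_def diag_corner_def cell_x_def cell_y_def)

lemma black_corner_eq: "black_corner n r = diag_corner n (2*r+1)"
  by (auto simp: fun_eq_iff black_corner_def diag_corner_def cell_x_def cell_y_def)

section \<open>From counts to probabilities\<close>

lemma prob_random_tiling: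
  assumes "perfect_matchings (aztec_edges n) (aztec_cells n) \<noteq> {}"
  shows "measure_pmf.prob (random_tiling n) {T. P T} =
    real (card {M \<in> perfect_matchings (aztec_edges n) (aztec_cells n). P (tile n ` M)}) /
    real (card (perfect_matchings (aztec_edges n) (aztec_cells n)))"
proof -
  let ?PM = "perfect_matchings (aztec_edges n) (aztec_cells n)"
  have inj: "inj_on ((`) (tile n)) ?PM" and img: "(`) (tile n) ` ?PM = aztec_tilings n"
    using bij_betw_matchings_tilings by (auto simp: bij_betw_def)
  have "finite ?PM" by (rule finite_perfect_matchings[OF finite_aztec_cells])
  hence "finite (aztec_tilings n)" "aztec_tilings n \<noteq> {}"
    unfolding img[symmetric] using assms by auto
  hence "measure_pmf.prob (random_tiling n) {T. P T} =
      card (aztec_tilings n \<inter> {T. P T}) / card (aztec_tilings n)"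
    unfolding random_tiling_def by (intro measure_pmf_of_set)
  also have "aztec_tilings n \<inter> {T. P T} = (`) (tile n) ` {M \<in> ?PM. P (tile n ` M)}"
    unfolding img[symmetric] by blast
  also have "card \<dots> = card {M \<in> ?PM. P (tile n ` M)}"
    by (rule card_image) (rule inj_on_subset[OF inj], blast)
  also have "card (aztec_tilings n) = card ?PM"
    unfolding img[symmetric] by (rule card_image[OF inj])
  finally show ?thesis .
qed

theorem proposition5p4:
  fixes n r :: nat
  assumes "1 \<le> n" and "1 \<le> r" and "r \<le> n"
  shows
    "(\<forall>h :: nat \<Rightarrow> nat. inj_on h {1..r} \<and> h ` {1..r} \<subseteq> {0..n} \<longrightarrow>
        measure_pmf.prob (random_tiling n)
          {T. white_zigzag n r T = white_path_at n r (h ` {1..r})}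
        = fact r * krawtchouk r n (1/2) h) \<and>
     (\<forall>h :: nat \<Rightarrow> nat. inj_on h {1..r} \<and> h ` {1..r} \<subseteq> {0..n - 1} \<longrightarrow>
        measure_pmf.prob (random_tiling n)
          {T. black_zigzag n r T = black_path_at n r (h ` {1..r})}
        = fact r * krawtchouk r (n - 1) (1/2) h)"
proof (intro conjI allI impI; elim conjE)
  \<comment> \<open>The number of matchings is a power of two; nonemptiness is what makes
    \<open>pmf_of_set\<close> the uniform distribution.\<close>
  have nonempty: "perfect_matchings (aztec_edges n) (aztec_cells n) \<noteq> {}"
    using card_aztec_matchings_eq[of n] by auto
  fix h :: "nat \<Rightarrow> nat"
  let ?H = "h ` {1..r}"
  assume inj: "inj_on h {1..r}"
  {
    assume "?H \<subseteq> {0..n}"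
    hence H: "?H \<subseteq> {..n}" by (simp only: atLeast0AtMost)
    have "white_zigzag n r (tile n ` M) = white_path_at n r ?H \<longleftrightarrow> covered_above n M (2*r) = {..n} - ?H"
      if "M \<in> perfect_matchings (aztec_edges n) (aztec_cells n)" for M
      using tiling_zigzag_eq_path_iff[OF that, of "2*r" "n + 1" ?H] assms H
      unfolding white_zigzag_def white_path_at_def white_corner_eq
      by (simp add: diag_def lessThan_Suc_atMost)
    hence "{M \<in> perfect_matchings (aztec_edges n) (aztec_cells n).
          white_zigzag n r (tile n ` M) = white_path_at n r ?H} =
        {M \<in> perfect_matchings (aztec_edges n) (aztec_cells n). covered_above n M (2*r) = {..n} - ?H}"
      by blast
    thus "measure_pmf.prob (random_tiling n) {T. white_zigzag n r T = white_path_at n r ?H} =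
        fact r * krawtchouk r n (1/2) h"
      using white_probability[OF assms(2,3) inj H] by (simp only: prob_random_tiling[OF nonempty])
  }
  {
    assume "?H \<subseteq> {0..n - 1}"
    moreover have "{0..n - 1} = {..<n}" using assms(1) by auto
    ultimately have H: "?H \<subseteq> {..<n}" by (simp only:)
    \<comment> \<open>East/south turns mark the squares not matched upwards, and
      \<open>black_path_at\<close> prescribes the other turns, so two complements cancel.\<close>
    hence compl: "{..<n} - ({..<n} - ?H) = ?H" by blast
    have "black_zigzag n r (tile n ` M) = black_path_at n r ?H \<longleftrightarrow> covered_above n M (2*r+1) = ?H"
      if "M \<in> perfect_matchings (aztec_edges n) (aztec_cells n)" for M
      using tiling_zigzag_eq_path_iff[OF that, of "2*r+1" n "{..<n} - ?H"] assms
      unfolding black_zigzag_def black_path_at_def black_corner_eq compl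
      by (simp add: diag_def)
    hence "{M \<in> perfect_matchings (aztec_edges n) (aztec_cells n).
          black_zigzag n r (tile n ` M) = black_path_at n r ?H} =
        {M \<in> perfect_matchings (aztec_edges n) (aztec_cells n). covered_above n M (2*r+1) = ?H}"
      by blast
    thus "measure_pmf.prob (random_tiling n) {T. black_zigzag n r T = black_path_at n r ?H} =
        fact r * krawtchouk r (n - 1) (1/2) h"
      using black_probability[OF assms(2,3) inj H] by (simp only: prob_random_tiling[OF nonempty])
  }
qed

end
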